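(* Let $n,i,j$ be integers with $1\le i<j\le n$, let $k$ be a field, let $R=k[x_1,\dots,x_n]$, let $I=(x_1^2,\dots,x_n^2)+\mathrm{RLex}(x_ix_j)$, and let $A=R/I$. Let $D$ be the socle degree of $A$. If the characteristic of $k$ is greater than $D$ (in particular, if the characteristic of $k$ is greater than $n$), then $A$ has the strong Lefschetz property.
   Context: The reverse lexicographic order with $x_1>\cdots>x_n$: for two monomials of the same degree, $x_1^{a_1}\cdots x_n^{a_n}>x_1^{b_1}\cdots x_n^{b_n}$ if the last non-zero entry of $(a_1,\dots,a_n)-(b_1,\dots,b_n)$ is negative. For $1\le i<j\le n$, $\mathrm{RLex}(x_ix_j)$ is the ideal of $R$ generated by all square-free monomials of degree 2 that are greater than or equal to $x_ix_j$ in this order; that is, by all $x_ax_b$ with $1\le a<b\le j-1$ together with $x_ax_j$ for $1\le a\le i$. The socle degree of an artinian standard graded algebra $A$ here means the largest $s$ with $A_s\ne 0$. A standard graded artinian $k$-algebra $A$ has the strong Lefschetz property (SLP) if there is a linear form $\ell\in A_1$ such that for all integers $s,d\ge 0$ the multiplication map $\cdot\ell^s:A_d\to A_{d+s}$ has full rank (i.e. is injective or surjective). *)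

theory Defs
  imports
    "HOL-Library.Poly_Mapping"
    "HOL-Algebra.Algebra"
    "HOL-Computational_Algebra.Computational_Algebra"
begin

text \<open>
  A monomial is its exponent vector \<open>nat \<Rightarrow>\<^sub>0 nat\<close>; a polynomial is a finitely supported
  function from monomials to coefficients. The type has a variable \<open>x\<^sub>t\<close> for every natural
  number \<open>t\<close>; the carrier of \<open>mpoly_ring n\<close> keeps only \<open>x\<^sub>1, \<dots>, x\<^sub>n\<close>.
\<close>

type_synonym mon = "nat \<Rightarrow>\<^sub>0 nat"
type_synonym 'k mpoly = "mon \<Rightarrow>\<^sub>0 'k"

definition mon_deg :: "mon \<Rightarrow> nat" where
  "mon_deg m = (\<Sum>t\<in>Poly_Mapping.keys m. Poly_Mapping.lookup m t)"

definition monomials :: "nat \<Rightarrow> mon set" where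
  "monomials n = {m. Poly_Mapping.keys m \<subseteq> {1..n}}"

definition mpoly_ring :: "nat \<Rightarrow> 'k::field mpoly ring" where
  "mpoly_ring n = \<lparr>carrier = {p. Poly_Mapping.keys p \<subseteq> monomials n},
     monoid.mult = (*), one = 1, ring.zero = 0, add = (+)\<rparr>"

lemma cring_mpoly_ring: "cring (mpoly_ring n :: 'k::field mpoly ring)"
proof -
  have closed_add: "Poly_Mapping.keys (p + q) \<subseteq> monomials n"
    if "Poly_Mapping.keys p \<subseteq> monomials n" "Poly_Mapping.keys q \<subseteq> monomials n"
    for p q :: "'k mpoly"
    using that Poly_Mapping.keys_add[of p q] by blast
  have closed_mult: "Poly_Mapping.keys (p * q) \<subseteq> monomials n"
    if "Poly_Mapping.keys p \<subseteq> monomials n" "Poly_Mapping.keys q \<subseteq> monomials n"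
    for p q :: "'k mpoly"
  proof
    fix m assume "m \<in> Poly_Mapping.keys (p * q)"
    then obtain a b where "m = a + b" "a \<in> Poly_Mapping.keys p" "b \<in> Poly_Mapping.keys q"
      using keys_mult[of p q] by auto
    then show "m \<in> monomials n"
      using that Poly_Mapping.keys_add[of a b] unfolding monomials_def by blast
  qed
  show ?thesis
  proof (rule cringI)
    show "abelian_group (mpoly_ring n :: 'k mpoly ring)"
    proof (rule abelian_groupI)
      fix x assume "x \<in> carrier (mpoly_ring n :: 'k mpoly ring)"
      then show "\<exists>y\<in>carrier (mpoly_ring n :: 'k mpoly ring).
          y \<oplus>\<^bsub>mpoly_ring n\<^esub> x = \<zero>\<^bsub>mpoly_ring n\<^esub>"
        by (intro bexI[of _ "- x"]) (auto simp: mpoly_ring_def)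
    qed (use closed_add[THEN subsetD] in \<open>auto simp: mpoly_ring_def add_ac\<close>)
    show "comm_monoid (mpoly_ring n :: 'k mpoly ring)"
    proof (rule comm_monoidI)
      show "\<one>\<^bsub>mpoly_ring n\<^esub> \<in> carrier (mpoly_ring n :: 'k mpoly ring)"
        by (auto simp: mpoly_ring_def monomials_def single_one[symmetric] simp del: single_one)
    qed (use closed_mult[THEN subsetD] in \<open>auto simp: mpoly_ring_def mult_ac\<close>)
  qed (auto simp: mpoly_ring_def algebra_simps)
qed

definition var_mon :: "nat \<Rightarrow> mon" where
  "var_mon t = Poly_Mapping.single t 1"

definition mon_poly :: "mon \<Rightarrow> 'k::field mpoly" where
  "mon_poly m = Poly_Mapping.single m 1"

definition homogeneous :: "nat \<Rightarrow> nat \<Rightarrow> 'k::field mpoly set" where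
  "homogeneous n d =
     {p \<in> carrier (mpoly_ring n). \<forall>m\<in>Poly_Mapping.keys p. mon_deg m = d}"

text \<open>
  The reverse lexicographic order with \<open>x\<^sub>1 > \<dots> > x\<^sub>n\<close> on monomials of the same degree:
  \<open>t\<close> below is the position of the last non-zero entry of the difference of the
  exponent vectors.
\<close>

definition revlex_gt :: "mon \<Rightarrow> mon \<Rightarrow> bool" where
  "revlex_gt a b \<longleftrightarrow> mon_deg a = mon_deg b \<and>
     (\<exists>t. int (Poly_Mapping.lookup a t) - int (Poly_Mapping.lookup b t) < 0 \<and>
        (\<forall>u>t. Poly_Mapping.lookup a u = Poly_Mapping.lookup b u))"

definition squarefree_mon :: "mon \<Rightarrow> bool" where
  "squarefree_mon m \<longleftrightarrow> (\<forall>t. Poly_Mapping.lookup m t \<le> 1)"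

definition RLex_mons :: "nat \<Rightarrow> nat \<Rightarrow> nat \<Rightarrow> mon set" where
  "RLex_mons n i j =
     {m \<in> monomials n. squarefree_mon m \<and> mon_deg m = 2 \<and>
        (m = var_mon i + var_mon j \<or> revlex_gt m (var_mon i + var_mon j))}"

lemma RLex_mons_eq:
  assumes "1 \<le> i" "i < j" "j \<le> n"
  shows "RLex_mons n i j =
    {var_mon a + var_mon b | a b. 1 \<le> a \<and> a < b \<and> b \<le> j - 1} \<union>
    {var_mon a + var_mon j | a. 1 \<le> a \<and> a \<le> i}"
  (is "_ = ?R")
proof -
  have lk: "Poly_Mapping.lookup (var_mon a + var_mon b) t =
      (if t = a then 1 else 0) + (if t = b then 1 else 0)" for a b t
    by (auto simp: var_mon_def lookup_add lookup_single when_def)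
  have ks: "Poly_Mapping.keys (var_mon a + var_mon b) = {a, b}" for a b
    by (auto simp: in_keys_iff lk split: if_splits)
  have deg: "mon_deg (var_mon a + var_mon b) = 2" if "a \<noteq> b" for a b
    using that unfolding mon_deg_def ks by (simp add: lk)
  have sq: "\<exists>a b. a < b \<and> m = var_mon a + var_mon b"
    if "squarefree_mon m" "mon_deg m = 2" for m
  proof -
    have l1: "Poly_Mapping.lookup m t = (if t \<in> Poly_Mapping.keys m then 1 else 0)" for t
      using that(1)[unfolded squarefree_mon_def, rule_format, of t]
      by (auto simp: in_keys_iff)
    then have "card (Poly_Mapping.keys m) = 2"
      using that(2) by (simp add: mon_deg_def)
    then obtain a b where ab: "Poly_Mapping.keys m = {a, b}" "a < b"
      by (metis card_2_iff insert_commute linorder_neqE_nat)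
    then have "m = var_mon a + var_mon b"
      by (intro poly_mapping_eqI) (auto simp: lk l1)
    with ab show ?thesis by blast
  qed
  have cmp: "(var_mon a + var_mon b = var_mon i + var_mon j \<or>
      revlex_gt (var_mon a + var_mon b) (var_mon i + var_mon j)) \<longleftrightarrow>
      b < j \<or> b = j \<and> a \<le> i" (is "?L \<longleftrightarrow> _") if "a < b" for a b
  proof
    assume ?L
    then show "b < j \<or> b = j \<and> a \<le> i"
    proof
      assume "var_mon a + var_mon b = var_mon i + var_mon j"
      then have "{a, b} = {i, j}" by (metis ks)
      with that assms show ?thesis by (auto simp: doubleton_eq_iff)
    next
      assume "revlex_gt (var_mon a + var_mon b) (var_mon i + var_mon j)"
      then obtain t where t: "int (Poly_Mapping.lookup (var_mon a + var_mon b) t)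
          - int (Poly_Mapping.lookup (var_mon i + var_mon j) t) < 0"
        and u: "\<And>u. u > t \<Longrightarrow> Poly_Mapping.lookup (var_mon a + var_mon b) u =
          Poly_Mapping.lookup (var_mon i + var_mon j) u"
        unfolding revlex_gt_def by blast
      have "t = i \<or> t = j" using t unfolding lk by (auto split: if_splits)
      then show ?thesis
      proof
        assume "t = i"
        show ?thesis
        proof (cases "b = j")
          case True
          with \<open>t = i\<close> u[of a] that assms show ?thesis
            unfolding lk by (cases "a \<le> i") auto
        next
          case False
          with \<open>t = i\<close> u[of j] u[of b] that assms show ?thesis
            unfolding lk by (cases "b < j") (auto split: if_splits)
        qed
      next
        assume "t = j"
        with t assms have "b \<noteq> j" unfolding lk by (auto split: if_splits)
        with \<open>t = j\<close> u[of b] that assms show ?thesis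
          unfolding lk by (cases "b < j") auto
      qed
    qed
  next
    assume r: "b < j \<or> b = j \<and> a \<le> i"
    have d: "mon_deg (var_mon a + var_mon b) = mon_deg (var_mon i + var_mon j)"
      using deg that assms by simp
    consider "b < j" | "b = j" "a = i" | "b = j" "a < i" using r by linarith
    then show ?L
    proof cases
      case 1
      then show ?thesis using that assms d
        unfolding revlex_gt_def lk by (intro disjI2 conjI exI[of _ j]) auto
    next
      case 3
      then show ?thesis using that assms d
        unfolding revlex_gt_def lk by (intro disjI2 conjI exI[of _ i]) auto
    qed simp
  qed
  have sf: "squarefree_mon (var_mon a + var_mon b)" if "a < b" for a b
    using that by (auto simp: squarefree_mon_def lk)
  have mn: "var_mon a + var_mon b \<in> monomials n \<longleftrightarrow> 1 \<le> a \<and> a \<le> n \<and> 1 \<le> b \<and> b \<le> n" for a b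
    by (auto simp: monomials_def ks)
  show ?thesis
  proof (intro equalityI subsetI)
    fix m assume m: "m \<in> RLex_mons n i j"
    then obtain a b where ab: "a < b" "m = var_mon a + var_mon b"
      using sq unfolding RLex_mons_def by blast
    from m have c: "b < j \<or> b = j \<and> a \<le> i" "1 \<le> a"
      using cmp[OF ab(1)] mn[of a b] unfolding RLex_mons_def ab(2) mem_Collect_eq by simp_all
    show "m \<in> ?R"
    proof (cases "b < j")
      case True
      then have "b \<le> j - 1" by simp
      with ab c show ?thesis by blast
    next
      case False
      with ab c show ?thesis by blast
    qed
  next
    fix m assume "m \<in> ?R"
    then obtain a b where ab: "m = var_mon a + var_mon b" "1 \<le> a" "a < b"
      "b < j \<or> b = j \<and> a \<le> i"
    proof
      assume "m \<in> {var_mon a + var_mon b | a b. 1 \<le> a \<and> a < b \<and> b \<le> j - 1}"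
      then obtain a b where "m = var_mon a + var_mon b" "1 \<le> a" "a < b" "b \<le> j - 1" by blast
      with assms show thesis by (intro that[of a b]) auto
    next
      assume "m \<in> {var_mon a + var_mon j | a. 1 \<le> a \<and> a \<le> i}"
      then obtain a where "m = var_mon a + var_mon j" "1 \<le> a" "a \<le> i" by blast
      with assms show thesis by (intro that[of a j]) auto
    qed
    moreover from ab assms have "a \<le> n" "1 \<le> b" "b \<le> n" by auto
    ultimately show "m \<in> RLex_mons n i j"
      unfolding RLex_mons_def using cmp[of a b] sf[of a b] deg[of a b] mn[of a b] by simp
  qed
qed

definition RLex :: "nat \<Rightarrow> nat \<Rightarrow> nat \<Rightarrow> 'k::field mpoly set" where
  "RLex n i j = Idl\<^bsub>mpoly_ring n\<^esub> (mon_poly ` RLex_mons n i j)"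

definition squares_ideal :: "nat \<Rightarrow> 'k::field mpoly set" where
  "squares_ideal n = Idl\<^bsub>mpoly_ring n\<^esub> {mon_poly (var_mon t) ^ 2 | t. t \<in> {1..n}}"

definition ideal_I :: "nat \<Rightarrow> nat \<Rightarrow> nat \<Rightarrow> 'k::field mpoly set" where
  "ideal_I n i j = squares_ideal n <+>\<^bsub>mpoly_ring n\<^esub> RLex n i j"

lemma ideal_ideal_I: "ideal (ideal_I n i j :: 'k::field mpoly set) (mpoly_ring n)"
proof -
  interpret R: cring "mpoly_ring n :: 'k mpoly ring" by (rule cring_mpoly_ring)
  have vm: "mon_poly m \<in> carrier (mpoly_ring n :: 'k mpoly ring)" if "m \<in> monomials n" for m
    using that by (auto simp: mon_poly_def mpoly_ring_def)
  have "mon_poly (var_mon t) ^ 2 \<in> carrier (mpoly_ring n :: 'k mpoly ring)" if "t \<in> {1..n}" for t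
  proof -
    have "mon_poly (var_mon t) \<in> carrier (mpoly_ring n :: 'k mpoly ring)"
      using that by (intro vm) (auto simp: monomials_def var_mon_def)
    from R.m_closed[OF this this] show ?thesis by (simp add: mpoly_ring_def power2_eq_square)
  qed
  then show ?thesis
    unfolding ideal_I_def squares_ideal_def RLex_def
    by (intro R.add_ideals R.genideal_ideal) (auto intro!: vm simp: RLex_mons_def)
qed

definition algebra_A :: "nat \<Rightarrow> nat \<Rightarrow> nat \<Rightarrow> 'k::field mpoly set ring" where
  "algebra_A n i j = mpoly_ring n Quot ideal_I n i j"

text \<open>The standard grading: \<open>A\<^sub>d\<close> is the image of the forms of degree \<open>d\<close>.\<close>

definition grading_A :: "nat \<Rightarrow> nat \<Rightarrow> nat \<Rightarrow> nat \<Rightarrow> 'k::field mpoly set set" where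
  "grading_A n i j d = (\<lambda>p. ideal_I n i j +>\<^bsub>mpoly_ring n\<^esub> p) ` homogeneous n d"

text \<open>
  In the next two definitions \<open>G d\<close> is the graded piece of degree \<open>d\<close> of the ring \<open>A\<close>.
  \<open>GREATEST\<close> is meaningful when \<open>A\<close> is artinian and nonzero: only finitely many,
  but not zero, pieces are nonzero.
\<close>

definition socle_degree :: "('a, 'b) ring_scheme \<Rightarrow> (nat \<Rightarrow> 'a set) \<Rightarrow> nat" where
  "socle_degree A G = (GREATEST s. G s \<noteq> {\<zero>\<^bsub>A\<^esub>})"

definition strong_lefschetz :: "('a, 'b) ring_scheme \<Rightarrow> (nat \<Rightarrow> 'a set) \<Rightarrow> bool" where
  "strong_lefschetz A G \<longleftrightarrow>
     (\<exists>l \<in> G 1. \<forall>s d.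
        inj_on (\<lambda>a. (l [^]\<^bsub>A\<^esub> s) \<otimes>\<^bsub>A\<^esub> a) (G d) \<or>
        (\<lambda>a. (l [^]\<^bsub>A\<^esub> s) \<otimes>\<^bsub>A\<^esub> a) ` G d = G (d + s))"

end

theory Submission
  imports Defs
begin

text \<open>
  The quotient \<open>A\<close> has a basis of square-free monomials \<open>x\<^sub>S\<close>, where \<open>S\<close> runs over the
  subsets of \<open>{1..n}\<close> that contain no pair \<open>{a, b}\<close> with \<open>x\<^sub>a x\<^sub>b \<in> RLex(x\<^sub>i x\<^sub>j)\<close>. So
  \<open>A = B \<otimes> k[x\<^sub>j\<^sub>+\<^sub>1, \<dots>, x\<^sub>n]/(squares)\<close> with \<open>B\<close> living in degrees at most 2. Let \<open>\<ell>\<close> be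
  the sum of the variables and consider the condition, for a number \<open>c\<close>: the map \<open>\<ell>\<^sup>s\<close> on
  degree \<open>d\<close> is injective if \<open>2d + s \<le> c\<close> and surjective if \<open>2d + s > c\<close>. It is immediate
  for \<open>B\<close>, with \<open>c\<close> the top degree of \<open>B\<close>, and adjoining a variable \<open>x\<close> with \<open>x\<^sup>2 = 0\<close>
  carries it from \<open>c\<close> to \<open>c + 1\<close>, because
  \<open>(\<ell> + x)\<^sup>s (u + x v) = \<ell>\<^sup>s u + x (\<ell>\<^sup>s v + s \<ell>\<^sup>s\<^sup>-\<^sup>1 u)\<close> and \<open>s \<le> c + 1\<close> is invertible in \<open>k\<close>.
\<close>

section \<open>Multiplication by the sum of the variables\<close>

text \<open>
  A function on sets supported on \<open>F\<close> stands for the combination of the monomials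
  \<open>x\<^sub>S\<close>, \<open>S \<in> F\<close>; \<open>sum_of_vars_map F\<close> is multiplication by \<open>\<ell>\<close>, with \<open>x\<^sub>S = 0\<close> for \<open>S \<notin> F\<close>.
\<close>

definition sum_of_vars_map :: "nat set set \<Rightarrow> (nat set \<Rightarrow> 'k::field) \<Rightarrow> nat set \<Rightarrow> 'k" where
  "sum_of_vars_map F f S = (if S \<in> F then \<Sum>t\<in>S. f (S - {t}) else 0)"

definition forms :: "nat set set \<Rightarrow> nat \<Rightarrow> (nat set \<Rightarrow> 'k::field) set" where
  "forms F d = {f. \<forall>S. f S \<noteq> 0 \<longrightarrow> S \<in> F \<and> card S = d}"

text \<open>The number \<open>2 * d + s\<close> is twice the midpoint of the degrees
  \<open>d\<close> and \<open>d + s\<close>, so one threshold decides which form of full rank is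
  claimed. The bound on \<open>card S\<close> makes every target degree above \<open>c\<close> zero.
  The \<open>itself\<close> argument pins the field, which occurs in no other argument.\<close>

definition lefschetz_about :: "'k::field itself \<Rightarrow> nat set set \<Rightarrow> nat \<Rightarrow> bool" where
  "lefschetz_about _ F c \<longleftrightarrow> (\<forall>S\<in>F. card S \<le> c) \<and>
     (\<forall>d s. 2 * d + s \<le> c \<longrightarrow>
        (\<forall>f\<in>forms F d. (sum_of_vars_map F ^^ s) f = (\<lambda>_. 0 :: 'k) \<longrightarrow> f = (\<lambda>_. 0))) \<and>
     (\<forall>d s. c < 2 * d + s \<longrightarrow>
        (\<forall>g\<in>forms F (d + s). \<exists>f\<in>forms F d. (sum_of_vars_map F ^^ s) f = (g :: nat set \<Rightarrow> 'k)))"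

text \<open>\<open>u + x v\<close> for \<open>u\<close> and \<open>v\<close> that do not involve \<open>x\<close>.\<close>

definition glue :: "nat \<Rightarrow> (nat set \<Rightarrow> 'k) \<Rightarrow> (nat set \<Rightarrow> 'k) \<Rightarrow> nat set \<Rightarrow> 'k" where
  "glue x u v S = (if x \<in> S then v (S - {x}) else u S)"

section \<open>Homogeneous forms and linearity of the multiplication map\<close>

lemma formsD: "f \<in> forms F d \<Longrightarrow> f S \<noteq> 0 \<Longrightarrow> S \<in> F \<and> card S = d"
  by (simp add: forms_def)

lemma forms_eqI:
  assumes "f \<in> forms F d" "g \<in> forms F d" "\<And>S. S \<in> F \<Longrightarrow> card S = d \<Longrightarrow> f S = g S"
  shows "f = g"
proof
  fix S show "f S = g S"
    using formsD[OF assms(1), of S] formsD[OF assms(2), of S] assms(3)[of S] by fastforce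
qed

lemma forms_above:
  assumes "\<And>S. S \<in> F \<Longrightarrow> card S \<le> c" "c < d" "f \<in> forms F d"
  shows "f = (\<lambda>_. 0)"
proof
  fix S show "f S = 0"
    using formsD[OF assms(3), of S] assms(1)[of S] assms(2) by fastforce
qed

lemma zero_forms: "(\<lambda>_. 0) \<in> forms F d"
  by (simp add: forms_def)

text \<open>Two free coefficients cover sums, differences and multiples at once. Several functions
  below carry an explicit factor \<open>1 *\<close> so that they have this shape.\<close>

lemma lincomb_forms: "f \<in> forms F d \<Longrightarrow> g \<in> forms F d \<Longrightarrow> (\<lambda>S. a * f S + b * g S) \<in> forms F d"
proof (unfold forms_def mem_Collect_eq, intro allI impI)
  fix S assume fg: "\<forall>S. f S \<noteq> 0 \<longrightarrow> S \<in> F \<and> card S = d" "\<forall>S. g S \<noteq> 0 \<longrightarrow> S \<in> F \<and> card S = d"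
    and "a * f S + b * g S \<noteq> 0"
  then have "f S \<noteq> 0 \<or> g S \<noteq> 0" by auto
  with fg show "S \<in> F \<and> card S = d" by blast
qed

lemma sum_of_vars_map_lincomb:
  "sum_of_vars_map F (\<lambda>S. a * f S + b * g S) =
     (\<lambda>S. a * sum_of_vars_map F f S + b * sum_of_vars_map F g S)"
  by (auto simp: sum_of_vars_map_def sum.distrib sum_distrib_left)

lemma pow_sum_of_vars_map_lincomb:
  "(sum_of_vars_map F ^^ s) (\<lambda>S. a * f S + b * g S) =
     (\<lambda>S. a * (sum_of_vars_map F ^^ s) f S + b * (sum_of_vars_map F ^^ s) g S)"
  by (induction s) (simp_all add: sum_of_vars_map_lincomb)

lemma pow_sum_of_vars_map_zero: "(sum_of_vars_map F ^^ s) (\<lambda>_. 0) = (\<lambda>_. 0)"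
proof (induction s)
  case (Suc s)
  then show ?case by (simp add: sum_of_vars_map_def fun_eq_iff)
qed simp

lemma sum_of_vars_map_forms:
  assumes "\<And>S. S \<in> F \<Longrightarrow> finite S" "f \<in> forms F d"
  shows "sum_of_vars_map F f \<in> forms F (Suc d)"
  unfolding forms_def
proof (intro CollectI allI impI)
  fix S assume nz: "sum_of_vars_map F f S \<noteq> 0"
  then have S: "S \<in> F" by (auto simp: sum_of_vars_map_def split: if_splits)
  with nz have "(\<Sum>t\<in>S. f (S - {t})) \<noteq> 0" by (simp add: sum_of_vars_map_def)
  then obtain t where "t \<in> S" "f (S - {t}) \<noteq> 0"
    by (rule sum.not_neutral_contains_not_neutral)
  then have "card (S - {t}) = d" using formsD[OF assms(2)] by blast
  with S assms(1)[OF S] \<open>t \<in> S\<close> show "S \<in> F \<and> card S = Suc d"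
    by (simp only: card.remove[of S t])
qed

lemma pow_sum_of_vars_map_forms:
  assumes "\<And>S. S \<in> F \<Longrightarrow> finite S" "f \<in> forms F d"
  shows "(sum_of_vars_map F ^^ s) f \<in> forms F (d + s)"
proof (induction s)
  case (Suc s)
  then show ?case using sum_of_vars_map_forms[OF assms(1)] by simp
qed (use assms in simp)

section \<open>Adjoining a variable of square zero\<close>

context
  fixes F :: "nat set set" and x :: nat
  assumes fin: "\<And>S. S \<in> F \<Longrightarrow> finite S" and x: "\<And>S. S \<in> F \<Longrightarrow> x \<notin> S"
begin

lemma insert_mem_extend: "x \<notin> T \<Longrightarrow> insert x T \<in> F \<union> insert x ` F \<longleftrightarrow> T \<in> F"
proof
  assume T: "x \<notin> T" "insert x T \<in> F \<union> insert x ` F"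
  with x obtain U where "U \<in> F" "insert x T = insert x U" by blast
  with x[of U] T(1) show "T \<in> F" by (simp add: insert_ident)
qed simp

lemma mem_extend: "x \<notin> T \<Longrightarrow> T \<in> F \<union> insert x ` F \<longleftrightarrow> T \<in> F"
  by auto

lemma glue_forms:
  assumes "u \<in> forms F (Suc d)" "v \<in> forms F d"
  shows "glue x u v \<in> forms (F \<union> insert x ` F) (Suc d)"
  unfolding forms_def
proof (intro CollectI allI impI)
  fix S assume nz: "glue x u v S \<noteq> 0"
  show "S \<in> F \<union> insert x ` F \<and> card S = Suc d"
  proof (cases "x \<in> S")
    case True
    with nz have m: "S - {x} \<in> F" "card (S - {x}) = d"
      using formsD[OF assms(2), of "S - {x}"] True by (simp_all add: glue_def)
    have "S = insert x (S - {x})" using True by blast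
    moreover have "card S = Suc d"
      using fin[OF m(1)] m(2) True by (metis card.remove finite_Diff2 finite.emptyI finite.insertI)
    ultimately show ?thesis using m(1) by blast
  next
    case False
    with nz show ?thesis using formsD[OF assms(1), of S] by (simp add: glue_def)
  qed
qed

text \<open>This is \<open>(\<ell> + x) (u + x v) = \<ell> u + x (\<ell> v + u)\<close>, by
  \<open>x\<^sup>2 = 0\<close>. The support of \<open>u\<close> matters at \<open>insert x T\<close>
  with \<open>T \<notin> F\<close>: the left side is 0 there, and the right side is
  \<open>u T\<close>.\<close>

lemma sum_of_vars_map_glue:
  assumes "u \<in> forms F d"
  shows "sum_of_vars_map (F \<union> insert x ` F) (glue x u v) =
     glue x (sum_of_vars_map F u) (\<lambda>S. sum_of_vars_map F v S + u S)"
proof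
  fix S
  show "sum_of_vars_map (F \<union> insert x ` F) (glue x u v) S =
     glue x (sum_of_vars_map F u) (\<lambda>S. sum_of_vars_map F v S + u S) S"
  proof (cases "x \<in> S")
    case False
    then show ?thesis
      using mem_extend[OF False] by (simp only: sum_of_vars_map_def glue_def) simp
  next
    case True
    define T where "T = S - {x}"
    with True have T: "S = insert x T" "x \<notin> T" by auto
    show ?thesis
    proof (cases "T \<in> F")
      case True
      have "glue x u v (insert x T - {t}) = v (T - {t})" if "t \<in> T" for t
      proof -
        have "insert x T - {t} - {x} = T - {t}" "x \<noteq> t" using T that by auto
        then show ?thesis by (simp add: glue_def)
      qed
      then show ?thesis
        using True T fin[OF True] insert_mem_extend[OF T(2)]
        by (simp add: sum_of_vars_map_def glue_def)
    next
      case False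
      then have "u T = 0" using formsD[OF assms] by blast
      with False T insert_mem_extend[OF T(2)] show ?thesis
        by (simp add: sum_of_vars_map_def glue_def)
    qed
  qed
qed

text \<open>Since \<open>x\<^sup>2 = 0\<close>, the binomial expansion of
  \<open>(\<ell> + x)\<^sup>s\<close> stops after the term linear in \<open>x\<close>. Writing the
  exponent as \<open>Suc s\<close> avoids a truncated subtraction in the power applied to
  \<open>u\<close>.\<close>

lemma pow_sum_of_vars_map_glue:
  assumes u: "u \<in> forms F d"
  shows "(sum_of_vars_map (F \<union> insert x ` F) ^^ Suc s) (glue x u v) =
     glue x ((sum_of_vars_map F ^^ Suc s) u)
       (\<lambda>S. (sum_of_vars_map F ^^ Suc s) v S + of_nat (Suc s) * (sum_of_vars_map F ^^ s) u S)"
proof (induction s)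
  case 0
  show ?case using sum_of_vars_map_glue[OF u] by simp
next
  case (Suc s)
  define w where "w = (\<lambda>S. 1 * (sum_of_vars_map F ^^ Suc s) v S +
    of_nat (Suc s) * (sum_of_vars_map F ^^ s) u S)"
  have "(sum_of_vars_map (F \<union> insert x ` F) ^^ Suc (Suc s)) (glue x u v) =
    sum_of_vars_map (F \<union> insert x ` F) (glue x ((sum_of_vars_map F ^^ Suc s) u) w)"
    unfolding funpow.simps(2)[of "Suc s"] o_apply Suc w_def mult_1 ..
  also have "\<dots> = glue x ((sum_of_vars_map F ^^ Suc (Suc s)) u)
      (\<lambda>S. sum_of_vars_map F w S + (sum_of_vars_map F ^^ Suc s) u S)"
    using sum_of_vars_map_glue[OF pow_sum_of_vars_map_forms[OF fin u, of "Suc s"]] by simp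
  also have "(\<lambda>S. sum_of_vars_map F w S + (sum_of_vars_map F ^^ Suc s) u S) =
      (\<lambda>S. (sum_of_vars_map F ^^ Suc (Suc s)) v S +
         of_nat (Suc (Suc s)) * (sum_of_vars_map F ^^ Suc s) u S)"
    unfolding w_def sum_of_vars_map_lincomb by (simp add: algebra_simps)
  finally show ?case .
qed

text \<open>For \<open>d = 0\<close> the truncated degree \<open>d - 1\<close> is again 0 and would
  admit a nonzero constant \<open>v\<close>; the third conclusion excludes this.\<close>

lemma glue_forms_cases:
  assumes f: "f \<in> forms (F \<union> insert x ` F) d"
  obtains u v where "u \<in> forms F d" "v \<in> forms F (d - 1)" "d = 0 \<Longrightarrow> v = (\<lambda>_. 0)" "f = glue x u v"
proof
  \<comment> \<open>\<open>glue\<close> reads \<open>v\<close> only at sets without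
    \<open>x\<close>; the value 0 elsewhere keeps the support of \<open>v\<close> inside
    \<open>F\<close>.\<close>
  let ?v = "\<lambda>S. if x \<in> S then 0 else f (insert x S)"
  show "(\<lambda>S. if x \<in> S then 0 else f S) \<in> forms F d"
    using formsD[OF f] unfolding forms_def
    by (smt (verit, best) Un_iff image_iff insertI1 mem_Collect_eq)
  have v: "S \<in> F \<and> Suc (card S) = d" if "?v S \<noteq> 0" for S
  proof -
    from that have S: "x \<notin> S" "f (insert x S) \<noteq> 0" by (auto split: if_splits)
    with formsD[OF f] have "insert x S \<in> F \<union> insert x ` F" "card (insert x S) = d"
      by blast+
    moreover from this(1) have "S \<in> F" by (simp only: insert_mem_extend[OF S(1)])
    ultimately show ?thesis using fin S by simp
  qed
  then show "?v \<in> forms F (d - 1)"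
    unfolding forms_def mem_Collect_eq by (metis diff_Suc_1)
  show "?v = (\<lambda>_. 0)" if "d = 0"
    using v that by (metis nat.distinct(1))
  show "f = glue x (\<lambda>S. if x \<in> S then 0 else f S) ?v"
    by (rule ext) (simp add: glue_def insert_absorb)
qed

lemma glue_eq_glue:
  assumes "glue x a b = glue x a' b'" "a \<in> forms F d" "b \<in> forms F e" "a' \<in> forms F d" "b' \<in> forms F e"
  shows "a = a'" "b = b'"
proof -
  show "a = a'"
  proof (rule forms_eqI[OF assms(2,4)])
    fix S assume "S \<in> F"
    then show "a S = a' S" using fun_cong[OF assms(1), of S] x by (auto simp: glue_def)
  qed
  show "b = b'"
  proof (rule forms_eqI[OF assms(3,5)])
    fix S assume "S \<in> F"
    with x have "x \<notin> S" by blast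
    then show "b S = b' S" using fun_cong[OF assms(1), of "insert x S"] by (auto simp: glue_def)
  qed
qed

end

text \<open>In both halves \<open>\<ell>\<close> is applied to the \<open>x\<close>-component of
  \<open>(\<ell> + x)\<^sup>s (u + x v)\<close>, and the other component eliminates
  \<open>u\<close>. This leaves \<open>v\<close> in degree \<open>d - 1\<close> with exponent
  \<open>s + 1\<close>, and then \<open>u\<close> in degree \<open>d\<close> with exponent
  \<open>s - 1\<close>. Both times the number compared with \<open>c\<close> is
  \<open>2 d + s - 1\<close>, so the threshold moves by exactly one.\<close>

lemma lefschetz_about_extend:
  fixes F :: "nat set set" and x :: nat
  assumes fin: "\<And>S. S \<in> F \<Longrightarrow> finite S" and x: "\<And>S. S \<in> F \<Longrightarrow> x \<notin> S"
    and lef: "lefschetz_about TYPE('k::field) F c"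
    and inv: "\<And>s. 1 \<le> s \<Longrightarrow> s \<le> Suc c \<Longrightarrow> of_nat s \<noteq> (0 :: 'k)"
  shows "lefschetz_about TYPE('k) (F \<union> insert x ` F) (Suc c)"
proof -
  let ?F' = "F \<union> insert x ` F"
  have top: "\<And>S. S \<in> F \<Longrightarrow> card S \<le> c"
    using lef by (auto simp: lefschetz_about_def)
  have inj: "f = (\<lambda>_. 0)" if "2 * d + s \<le> c" "f \<in> forms F d" "(sum_of_vars_map F ^^ s) f = (\<lambda>_. 0)"
    for d s and f :: "nat set \<Rightarrow> 'k"
    using lef that unfolding lefschetz_about_def by blast
  have surj: "\<exists>f\<in>forms F d. (sum_of_vars_map F ^^ s) f = g" if "c < 2 * d + s" "g \<in> forms F (d + s)"
    for d s and g :: "nat set \<Rightarrow> 'k"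
    using lef that unfolding lefschetz_about_def by blast
  have top': "card S \<le> Suc c" if "S \<in> ?F'" for S
    using that top fin x by (force simp: card_insert_if intro: le_SucI)
  have inj': "f = (\<lambda>_. 0)"
    if le: "2 * d + s \<le> Suc c" and f: "f \<in> forms ?F' d"
      and z: "(sum_of_vars_map ?F' ^^ s) f = (\<lambda>_. 0)"
    for d s and f :: "nat set \<Rightarrow> 'k"
  proof (cases s)
    case 0
    with z show ?thesis by simp
  next
    case (Suc r)
    obtain u v where u: "u \<in> forms F d" and v: "v \<in> forms F (d - 1)"
      "d = 0 \<Longrightarrow> v = (\<lambda>_. 0)" and f_eq: "f = glue x u v"
      by (rule glue_forms_cases[OF fin x f]) blast+
    \<comment> \<open>\<open>a\<close> and \<open>b\<close> are the two components of the image of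
      \<open>f\<close>, in degrees \<open>d + s\<close> and \<open>d + s - 1\<close>; both must
      vanish.\<close>
    define a where "a = (sum_of_vars_map F ^^ Suc r) u"
    define b where "b = (\<lambda>S. 1 * (sum_of_vars_map F ^^ Suc r) v S +
      of_nat (Suc r) * (sum_of_vars_map F ^^ r) u S)"
    \<comment> \<open>The degree count starts from \<open>d - 1\<close>, so it is right only for
      positive \<open>d\<close>; for \<open>d = 0\<close> the form \<open>v\<close> is zero.\<close>
    have "(sum_of_vars_map F ^^ Suc r) v \<in> forms F (d + r)"
    proof (cases d)
      case 0
      show ?thesis unfolding v(2)[OF 0] pow_sum_of_vars_map_zero by (rule zero_forms)
    next
      case (Suc e)
      then show ?thesis using pow_sum_of_vars_map_forms[OF fin v(1), of "Suc r"] by simp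
    qed
    then have b: "b \<in> forms F (d + r)"
      unfolding b_def by (intro lincomb_forms pow_sum_of_vars_map_forms[OF fin u])
    have "glue x a b = glue x (\<lambda>_. 0) (\<lambda>_. 0)"
      using z pow_sum_of_vars_map_glue[OF fin x u, of r v]
      unfolding f_eq Suc a_def b_def mult_1 by (simp add: glue_def fun_eq_iff)
    note ab = glue_eq_glue[OF fin x this
        pow_sum_of_vars_map_forms[OF fin u, of "Suc r", folded a_def] b zero_forms zero_forms]
    have v0: "v = (\<lambda>_. 0)"
    proof (cases d)
      case (Suc e)
      \<comment> \<open>The \<open>u\<close>-part of \<open>\<ell> b\<close> is a multiple of
        \<open>a = 0\<close>, so the power \<open>r + 2\<close> of \<open>\<ell>\<close> kills
        \<open>v\<close>.\<close>
      have "sum_of_vars_map F b = (\<lambda>S. 1 * (sum_of_vars_map F ^^ Suc (Suc r)) v S + of_nat (Suc r) * a S)"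
        unfolding b_def sum_of_vars_map_lincomb a_def by simp
      moreover have "sum_of_vars_map F b = (\<lambda>_. 0)"
        using ab(2) pow_sum_of_vars_map_zero[of 1 F] by simp
      ultimately have "(sum_of_vars_map F ^^ Suc (Suc r)) v = (\<lambda>_. 0)"
        by (simp add: ab(1) fun_eq_iff)
      then show ?thesis
        using inj[of e "Suc (Suc r)" v] v(1) le \<open>s = Suc r\<close> Suc by simp
    qed (rule v(2))
    \<comment> \<open>With \<open>v = 0\<close>, the equation \<open>b = 0\<close> says that
      \<open>s\<close> times \<open>\<ell>\<^sup>r u\<close> is zero; here the invertibility of
      \<open>s\<close> enters.\<close>
    have "of_nat (Suc r) * (sum_of_vars_map F ^^ r) u S = b S" for S
      unfolding b_def v0 pow_sum_of_vars_map_zero by simp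
    then have "of_nat (Suc r) * (sum_of_vars_map F ^^ r) u S = 0" for S
      by (simp only: ab(2))
    moreover have "of_nat (Suc r) \<noteq> (0 :: 'k)"
      using inv[of "Suc r"] le Suc by simp
    ultimately have "(sum_of_vars_map F ^^ r) u = (\<lambda>_. 0)"
      by (metis mult_eq_0_iff)
    then have "u = (\<lambda>_. 0)"
      using inj[of d r u] le Suc u by simp
    with v0 show ?thesis by (simp add: f_eq glue_def fun_eq_iff)
  qed
  have surj': "\<exists>f\<in>forms ?F' d. (sum_of_vars_map ?F' ^^ s) f = g"
    if less: "Suc c < 2 * d + s" and g: "g \<in> forms ?F' (d + s)"
    for d s and g :: "nat set \<Rightarrow> 'k"
  proof -
    \<comment> \<open>If \<open>d = 0\<close>, then \<open>2 * d + s = d + s\<close> and the second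
      case applies. The third case has \<open>s \<le> c + 1\<close>, so \<open>s\<close> is
      invertible.\<close>
    consider "s = 0" | "Suc c < d + s" | r e where "s = Suc r" "d = Suc e" "d + s \<le> Suc c"
      using less by (cases s; cases d) fastforce+
    then show ?thesis
    proof cases
      case 1
      with g show ?thesis by auto
    next
      case 2
      with forms_above[OF top' _ g] have "g = (\<lambda>_. 0)" by blast
      then show ?thesis using zero_forms pow_sum_of_vars_map_zero by blast
    next
      case 3
      obtain p q where p: "p \<in> forms F (d + s)" and q: "q \<in> forms F (d + s - 1)"
        and g_eq: "g = glue x p q"
        by (rule glue_forms_cases[OF fin x g]) blast+
      define k :: 'k where "k = of_nat (Suc r)"
      have k: "k \<noteq> 0" unfolding k_def using inv[of "Suc r"] 3 by simp
      have q1: "q \<in> forms F (e + Suc r)" and p1: "p \<in> forms F (Suc (e + Suc r))"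
        using p q 3 by simp_all
      \<comment> \<open>The system to solve is \<open>\<ell>\<^sup>s u = p\<close> and
        \<open>\<ell>\<^sup>s v + k \<ell>\<^sup>r u = q\<close>. Applying \<open>\<ell>\<close> to
        the second equation and inserting the first gives this right-hand side for the power
        \<open>r + 2\<close> of \<open>\<ell>\<close> on \<open>v\<close>.\<close>
      have "(\<lambda>S. 1 * sum_of_vars_map F q S + (- k) * p S) \<in> forms F (e + Suc (Suc r))"
        using lincomb_forms[OF sum_of_vars_map_forms[OF fin q1] p1, of 1 "- k"] by simp
      with surj[of e "Suc (Suc r)"] less 3 obtain v where v: "v \<in> forms F e"
        and Lv: "(sum_of_vars_map F ^^ Suc (Suc r)) v = (\<lambda>S. 1 * sum_of_vars_map F q S + (- k) * p S)"
        by auto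
      \<comment> \<open>The second equation forces \<open>\<ell>\<^sup>r u = w\<close>. The choice
        of \<open>v\<close> makes \<open>\<ell> w = p\<close>, so any such \<open>u\<close> also
        solves the first equation.\<close>
      define w where "w = (\<lambda>S. (1 / k) * q S + (- (1 / k)) * (sum_of_vars_map F ^^ Suc r) v S)"
      have "w \<in> forms F (d + r)"
        using lincomb_forms[OF q1 pow_sum_of_vars_map_forms[OF fin v, of "Suc r"], of "1/k" "- (1/k)"]
        unfolding w_def 3 by simp
      with surj[of d r] less 3 obtain u where u: "u \<in> forms F d" and Lu: "(sum_of_vars_map F ^^ r) u = w"
        by auto
      have "(sum_of_vars_map F ^^ Suc r) u = sum_of_vars_map F w"
        by (simp add: Lu)
      also have "\<dots> = (\<lambda>S. (1 / k) * sum_of_vars_map F q S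
          + (- (1 / k)) * (sum_of_vars_map F ^^ Suc (Suc r)) v S)"
        unfolding w_def sum_of_vars_map_lincomb by simp
      also have "\<dots> = p"
        unfolding Lv using k by (simp add: fun_eq_iff field_simps)
      finally have Lu': "(sum_of_vars_map F ^^ Suc r) u = p" .
      have "(\<lambda>S. (sum_of_vars_map F ^^ Suc r) v S + k * (sum_of_vars_map F ^^ r) u S) = q"
        unfolding Lu w_def using k by (simp add: fun_eq_iff field_simps)
      then have "(sum_of_vars_map ?F' ^^ s) (glue x u v) = g"
        using pow_sum_of_vars_map_glue[OF fin x u, of r v]
        unfolding g_eq 3 Lu' k_def by (simp only:)
      moreover have "glue x u v \<in> forms ?F' d"
        using glue_forms[OF fin x] u v 3 by simp
      ultimately show ?thesis by blast
    qed
  qed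
  show ?thesis
    unfolding lefschetz_about_def by (intro conjI ballI allI impI) (fact top' inj' surj')+
qed

section \<open>Independent sets\<close>

text \<open>The independent sets of the graph whose edges are the generators of
  \<open>RLex n i j\<close>, in the explicit form of \<open>RLex_mons_eq\<close>.\<close>

definition indep_sets :: "nat \<Rightarrow> nat \<Rightarrow> nat \<Rightarrow> nat set set" where
  "indep_sets n i j = {S. S \<subseteq> {1..n} \<and> \<not> (\<exists>a\<in>S. \<exists>b\<in>S. a < b \<and> (b < j \<or> b = j \<and> a \<le> i))}"

text \<open>The top degree of \<open>B\<close>.\<close>

definition core_top :: "nat \<Rightarrow> nat \<Rightarrow> nat" where
  "core_top i j = (if Suc i < j then 2 else 1)"

lemma indep_sets_finite: "S \<in> indep_sets n i j \<Longrightarrow> finite S"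
  by (auto simp: indep_sets_def intro: finite_subset)

lemma indep_sets_subset: "S \<in> indep_sets n i j \<Longrightarrow> S \<subseteq> {1..n}"
  by (simp add: indep_sets_def)

lemma indep_sets_mono: "S \<in> indep_sets n i j \<Longrightarrow> T \<subseteq> S \<Longrightarrow> T \<in> indep_sets n i j"
  unfolding indep_sets_def by blast

text \<open>The vertex \<open>Suc n\<close> lies beyond \<open>j\<close>, hence in no forbidden
  pair, and can be joined to any independent set.\<close>

lemma indep_sets_Suc:
  assumes "j \<le> n"
  shows "indep_sets (Suc n) i j = indep_sets n i j \<union> insert (Suc n) ` indep_sets n i j"
proof (intro equalityI subsetI)
  fix S assume S: "S \<in> indep_sets (Suc n) i j"
  show "S \<in> indep_sets n i j \<union> insert (Suc n) ` indep_sets n i j"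
  proof (cases "Suc n \<in> S")
    case True
    have "S - {Suc n} \<in> indep_sets n i j"
      using S by (auto simp: indep_sets_def atLeastAtMostSuc_conv)
    moreover have "S = insert (Suc n) (S - {Suc n})" using True by blast
    ultimately show ?thesis by blast
  next
    case False
    with S show ?thesis by (auto simp: indep_sets_def atLeastAtMostSuc_conv)
  qed
next
  fix S assume "S \<in> indep_sets n i j \<union> insert (Suc n) ` indep_sets n i j"
  with assms show "S \<in> indep_sets (Suc n) i j"
    by (auto simp: indep_sets_def)
qed

section \<open>The factor \<open>B\<close> in the first \<open>j\<close> variables, and the passage
  to \<open>n\<close> variables\<close>

context
  fixes i j :: nat
  assumes ij: "1 \<le> i" "i < j"
begin

text \<open>Of any two elements the larger must be \<open>j\<close> and the smaller must exceed
  \<open>i\<close>. A third element would form with \<open>a < j\<close> a pair whose larger element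
  is not \<open>j\<close>.\<close>

lemma indep_sets_core_cases:
  assumes "S \<in> indep_sets j i j"
  obtains "S = {}" | a where "1 \<le> a" "a \<le> j" "S = {a}" | a where "i < a" "a < j" "S = {a, j}"
proof -
  have sub: "S \<subseteq> {1..j}" using assms by (rule indep_sets_subset)
  have e: "b = j \<and> i < a" if "a \<in> S" "b \<in> S" "a < b" for a b
  proof -
    have "b \<le> j" using sub that by auto
    moreover have "\<not> (b < j \<or> b = j \<and> a \<le> i)" using assms that unfolding indep_sets_def by blast
    ultimately show ?thesis by auto
  qed
  show thesis
  proof (cases "\<exists>a\<in>S. \<exists>b\<in>S. a < b")
    case True
    then obtain a where a: "a \<in> S" "j \<in> S" "i < a" "a < j" using e by blast
    have "x = a \<or> x = j" if "x \<in> S" for x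
    proof (rule ccontr)
      assume n: "\<not> (x = a \<or> x = j)"
      then consider "x < a" | "a < x" by linarith
      then show False
      proof cases
        case 1
        with e[OF that a(1)] a(4) show ?thesis by simp
      next
        case 2
        with e[OF a(1) that] n show ?thesis by simp
      qed
    qed
    with a(1,2) have "S = {a, j}" by blast
    with a(3,4) show ?thesis by (rule that(3))
  next
    case False
    show ?thesis
    proof (cases "S = {}")
      case True
      then show ?thesis by (rule that(1))
    next
      case nonempty: False
      then obtain a where "a \<in> S" by blast
      moreover have "x = a" if "x \<in> S" for x
        using False that \<open>a \<in> S\<close> by (meson linorder_neqE_nat)
      ultimately have "S = {a}" by blast
      moreover from this sub have "1 \<le> a" "a \<le> j" by simp_all
      ultimately show ?thesis using that(2) by simp
    qed
  qed
qed

lemma singleton_core: "1 \<le> a \<Longrightarrow> a \<le> j \<Longrightarrow> {a} \<in> indep_sets j i j"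
  by (simp add: indep_sets_def)

lemma pair_core: "i < a \<Longrightarrow> a < j \<Longrightarrow> {a, j} \<in> indep_sets j i j"
  using ij by (auto simp: indep_sets_def)

text \<open>Pairs \<open>{a, j}\<close> with \<open>i < a < j\<close> exist only if
  \<open>Suc i < j\<close>; this is the case split in \<open>core_top\<close>.\<close>

lemma card_core:
  assumes "S \<in> indep_sets j i j"
  shows "card S \<le> core_top i j"
  using assms by (cases rule: indep_sets_core_cases) (auto simp: core_top_def)

lemma sum_of_vars_map_singleton:
  "1 \<le> a \<Longrightarrow> a \<le> j \<Longrightarrow> sum_of_vars_map (indep_sets j i j) f {a} = f {}"
  using singleton_core by (simp add: sum_of_vars_map_def)

lemma sum_of_vars_map_pair:
  assumes "i < a" "a < j" 
  shows "sum_of_vars_map (indep_sets j i j) f {a, j} = f {j} + f {a}"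
proof -
  have "{a, j} - {a} = {j}" "{a, j} - {j} = {a}" using assms by auto
  then show ?thesis using pair_core[OF assms] assms by (simp add: sum_of_vars_map_def)
qed

lemma lefschetz_about_core:
  assumes two: "Suc i < j \<Longrightarrow> (2 :: 'k::field) \<noteq> 0"
  shows "lefschetz_about TYPE('k) (indep_sets j i j) (core_top i j)"
proof -
  let ?F = "indep_sets j i j" and ?c = "core_top i j"
  let ?L = "sum_of_vars_map ?F"
  have inj: "f = (\<lambda>_. 0)"
    if le: "2 * d + s \<le> ?c" and f: "f \<in> forms ?F d" and z: "(?L ^^ s) f = (\<lambda>_. 0)"
    for d s and f :: "nat set \<Rightarrow> 'k"
  proof (cases "s = 0")
    case True
    with z show ?thesis by simp
  next
    case False
    \<comment> \<open>The top degree is at most 2, so a positive exponent leaves only constants; it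
      remains to see that \<open>\<ell>\<^sup>s\<close> is nonzero.\<close>
    with le have d: "d = 0" and s: "s = 1 \<or> s = 2 \<and> Suc i < j"
      by (auto simp: core_top_def split: if_splits)
    from s have "f {} = 0"
    proof
      assume "s = 1"
      with z have "?L f {j} = 0" by simp
      then show ?thesis using ij by (simp add: sum_of_vars_map_singleton)
    next
      assume s: "s = 2 \<and> Suc i < j"
      \<comment> \<open>\<open>{Suc i, j}\<close> is an independent pair, and its monomial occurs in
        \<open>\<ell>\<^sup>2\<close> with coefficient 2.\<close>
      with z have "?L (?L f) {Suc i, j} = 0" by (simp add: numeral_2_eq_2)
      then have "2 * f {} = 0"
        using ij s by (simp add: sum_of_vars_map_singleton sum_of_vars_map_pair)
      with two s show ?thesis by simp
    qed
    show ?thesis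
    proof (rule forms_eqI[OF f zero_forms])
      fix S assume "S \<in> ?F" "card S = d"
      then have "S = {}" using d indep_sets_finite by auto
      with \<open>f {} = 0\<close> show "f S = 0" by simp
    qed
  qed
  have surj: "\<exists>f\<in>forms ?F d. (?L ^^ s) f = g"
    if less: "?c < 2 * d + s" and g: "g \<in> forms ?F (d + s)"
    for d s and g :: "nat set \<Rightarrow> 'k"
  proof -
    \<comment> \<open>The only surjectivity with content is from degree 1 to degree 2.\<close>
    consider "s = 0" | "?c < d + s" | "s = 1" "d = 1" "Suc i < j"
      using less by (cases s; cases d) (auto simp: core_top_def split: if_splits)
    then show ?thesis
    proof cases
      case 1
      with g show ?thesis by auto
    next
      case 2
      with forms_above[OF card_core _ g] have "g = (\<lambda>_. 0)" by blast
      then show ?thesis using zero_forms pow_sum_of_vars_map_zero by blast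
    next
      case 3
      \<comment> \<open>Degree 2 of \<open>B\<close> is spanned by the products of
        \<open>x\<^sub>a\<close> and \<open>x\<^sub>j\<close> with \<open>i < a < j\<close>, and in
        \<open>B\<close> such a product equals \<open>\<ell>\<close> times \<open>x\<^sub>a\<close>.
        So the coefficient at \<open>{a, j}\<close> is moved to \<open>{a}\<close>, and
        \<open>{j}\<close> gets 0.\<close>
      define f where "f = (\<lambda>S. if \<exists>a. i < a \<and> a < j \<and> S = {a} then g (insert j S) else 0)"
      have f: "f \<in> forms ?F d"
        unfolding forms_def f_def
      proof (intro CollectI allI impI)
        fix S assume "(if \<exists>a. i < a \<and> a < j \<and> S = {a} then g (insert j S) else 0) \<noteq> 0"
        then obtain a where "i < a" "a < j" "S = {a}" by (auto split: if_splits)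
        with 3 show "S \<in> ?F \<and> card S = d" by (simp add: singleton_core)
      qed
      moreover have "?L f = g"
      proof (rule forms_eqI)
        show "?L f \<in> forms ?F (d + s)"
          using sum_of_vars_map_forms[OF indep_sets_finite f] 3 by simp
        show "g \<in> forms ?F (d + s)" by (rule g)
        fix S assume S: "S \<in> ?F" "card S = d + s"
        from S(1) show "?L f S = g S"
        proof (cases rule: indep_sets_core_cases)
          case (3 a)
          have "f {j} = 0" "f {a} = g {a, j}"
            using 3 by (auto simp: f_def insert_commute)
          then show ?thesis using 3 by (simp add: sum_of_vars_map_pair)
        qed (use S 3 in auto)
      qed
      ultimately show ?thesis unfolding 3 by (intro bexI) simp_all
    qed
  qed
  show ?thesis
    unfolding lefschetz_about_def by (intro conjI ballI allI impI) (fact card_core inj surj)+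
qed

lemma lefschetz_about_indep_sets:
  assumes "j \<le> n" "\<And>s. 1 \<le> s \<Longrightarrow> s \<le> core_top i j + (n - j) \<Longrightarrow> of_nat s \<noteq> (0 :: 'k::field)"
  shows "lefschetz_about TYPE('k) (indep_sets n i j) (core_top i j + (n - j))"
  using assms
proof (induction n rule: dec_induct)
  case base
  \<comment> \<open>If \<open>Suc i < j\<close>, the top degree is 2, so 2 is among the integers
    assumed invertible.\<close>
  have "(2 :: 'k) \<noteq> 0" if "Suc i < j"
    using base[of 2] that by (simp add: core_top_def)
  from lefschetz_about_core[OF this] show ?case by simp
next
  case (step n)
  have eq: "core_top i j + (Suc n - j) = Suc (core_top i j + (n - j))"
    using step.hyps by simp
  have IH: "lefschetz_about TYPE('k) (indep_sets n i j) (core_top i j + (n - j))"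
  proof (rule step.IH)
    fix s assume "1 \<le> s" "s \<le> core_top i j + (n - j)"
    then show "of_nat s \<noteq> (0 :: 'k)" by (intro step.prems) (simp_all add: eq)
  qed
  show ?case
    unfolding eq indep_sets_Suc[OF step.hyps(1)]
  proof (rule lefschetz_about_extend)
    show "Suc n \<notin> S" if "S \<in> indep_sets n i j" for S
      using indep_sets_subset[OF that] by auto
  qed (fact indep_sets_finite IH step.prems[unfolded eq])+
qed

text \<open>The threshold is attained as a degree, which later bounds it by the socle degree. Every
  pair in \<open>{j..n}\<close> has its larger element beyond \<open>j\<close>, and
  \<open>Suc i\<close> may be added because it exceeds \<open>i\<close>.\<close>

lemma card_indep_sets:
  assumes "j \<le> n"
  shows "\<exists>S\<in>indep_sets n i j. card S = core_top i j + (n - j)"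
proof (cases "Suc i < j")
  case True
  have "card (insert (Suc i) {j..n}) = 2 + (n - j)"
    using True assms by simp
  moreover have "insert (Suc i) {j..n} \<in> indep_sets n i j"
    using True assms by (auto simp: indep_sets_def)
  ultimately show ?thesis using True by (intro bexI) (simp_all add: core_top_def)
next
  case False
  have "{j..n} \<in> indep_sets n i j" "card {j..n} = 1 + (n - j)"
    using assms ij by (auto simp: indep_sets_def)
  with False show ?thesis by (intro bexI) (simp_all add: core_top_def)
qed

end

section \<open>The monomial basis of the quotient\<close>

definition set_mon :: "nat set \<Rightarrow> mon" where
  "set_mon S = (\<Sum>t\<in>S. var_mon t)"

definition indep_mons :: "nat \<Rightarrow> nat \<Rightarrow> nat \<Rightarrow> mon set" where
  "indep_mons n i j = set_mon ` indep_sets n i j"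

text \<open>The coordinates of the class of \<open>p\<close> in the basis of the monomials
  \<open>x\<^sub>S\<close>; all other monomials are dropped.\<close>

definition indep_coeffs :: "nat \<Rightarrow> nat \<Rightarrow> nat \<Rightarrow> 'k::field mpoly \<Rightarrow> nat set \<Rightarrow> 'k" where
  "indep_coeffs n i j p S = (if S \<in> indep_sets n i j then Poly_Mapping.lookup p (set_mon S) else 0)"

definition sum_of_vars :: "nat \<Rightarrow> 'k::field mpoly" where
  "sum_of_vars n = (\<Sum>t\<in>{1..n}. mon_poly (var_mon t))"

section \<open>Coefficients and supports of monomials\<close>

lemma poly_mapping_sum_single:
  "(\<Sum>m\<in>Poly_Mapping.keys p. Poly_Mapping.single m (Poly_Mapping.lookup p m)) = p"
  by (rule poly_mapping_eqI)
    (simp add: lookup_sum lookup_single when_def sum.delta in_keys_iff)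

lemma lookup_single_mult:
  fixes c :: "'k::field" and p :: "'k mpoly"
  shows "Poly_Mapping.lookup (Poly_Mapping.single a c * p) m =
    (\<Sum>b\<in>Poly_Mapping.keys p. if a + b = m then c * Poly_Mapping.lookup p b else 0)"
proof -
  have "Poly_Mapping.single a c * p =
    (\<Sum>b\<in>Poly_Mapping.keys p. Poly_Mapping.single (a + b) (c * Poly_Mapping.lookup p b))"
    by (subst poly_mapping_sum_single[of p, symmetric])
      (simp only: sum_distrib_left mult_single)
  then show ?thesis by (simp add: lookup_sum lookup_single when_def)
qed

lemma lookup_single_mult_add:
  fixes c :: "'k::field" and p :: "'k mpoly"
  shows "Poly_Mapping.lookup (Poly_Mapping.single a c * p) (a + b) = c * Poly_Mapping.lookup p b"
  by (simp add: lookup_single_mult sum.delta in_keys_iff)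

lemma lookup_var_mon: "Poly_Mapping.lookup (var_mon a) t = (if t = a then 1 else 0)"
  by (simp add: var_mon_def lookup_single when_def)

lemma lookup_set_mon: "finite S \<Longrightarrow> Poly_Mapping.lookup (set_mon S) t = (if t \<in> S then 1 else 0)"
  by (simp only: set_mon_def lookup_sum lookup_var_mon sum.delta')

lemma keys_set_mon: "finite S \<Longrightarrow> Poly_Mapping.keys (set_mon S) = S"
proof (rule Set.set_eqI)
  fix t assume S: "finite S"
  show "t \<in> Poly_Mapping.keys (set_mon S) \<longleftrightarrow> t \<in> S"
    unfolding in_keys_iff lookup_set_mon[OF S] by simp
qed

lemma mon_deg_set_mon: "finite S \<Longrightarrow> mon_deg (set_mon S) = card S"
  by (simp add: mon_deg_def keys_set_mon lookup_set_mon)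

lemma set_mon_keys: "squarefree_mon m \<Longrightarrow> set_mon (Poly_Mapping.keys m) = m"
proof (rule poly_mapping_eqI)
  fix t assume "squarefree_mon m"
  then have le: "Poly_Mapping.lookup m t \<le> 1" unfolding squarefree_mon_def by blast
  show "Poly_Mapping.lookup (set_mon (Poly_Mapping.keys m)) t = Poly_Mapping.lookup m t"
  proof (cases "Poly_Mapping.lookup m t = 0")
    case True
    then show ?thesis by (simp add: lookup_set_mon in_keys_iff)
  next
    case False
    then show ?thesis using le by (simp add: lookup_set_mon in_keys_iff)
  qed
qed

lemma set_mon_remove: "finite S \<Longrightarrow> t \<in> S \<Longrightarrow> set_mon S = var_mon t + set_mon (S - {t})"
  by (simp add: set_mon_def sum.remove)

lemma set_mon_monomials: "S \<in> indep_sets n i j \<Longrightarrow> set_mon S \<in> monomials n"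
  unfolding monomials_def by (simp only: keys_set_mon indep_sets_finite indep_sets_subset mem_Collect_eq)

section \<open>The ideal as the span of the dependent monomials\<close>

lemma indep_mons_iff:
  "m \<in> indep_mons n i j \<longleftrightarrow> squarefree_mon m \<and> Poly_Mapping.keys m \<in> indep_sets n i j"
proof
  assume "m \<in> indep_mons n i j"
  then obtain S where "S \<in> indep_sets n i j" "m = set_mon S" by (auto simp: indep_mons_def)
  with indep_sets_finite[of S n i j] show "squarefree_mon m \<and> Poly_Mapping.keys m \<in> indep_sets n i j"
    by (simp add: keys_set_mon squarefree_mon_def lookup_set_mon)
next
  assume "squarefree_mon m \<and> Poly_Mapping.keys m \<in> indep_sets n i j"
  then show "m \<in> indep_mons n i j"
    unfolding indep_mons_def using imageI[of "Poly_Mapping.keys m" _ set_mon] set_mon_keys by auto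
qed

text \<open>Independent monomials are closed under divisors; equivalently, multiples of dependent
  ones are dependent.\<close>

lemma indep_mons_add: "a + b \<in> indep_mons n i j \<Longrightarrow> b \<in> indep_mons n i j"
proof -
  assume ab: "a + b \<in> indep_mons n i j"
  have "Poly_Mapping.keys b \<subseteq> Poly_Mapping.keys (a + b)"
    by (auto simp: in_keys_iff lookup_add)
  moreover have "squarefree_mon b"
    using ab unfolding indep_mons_iff squarefree_mon_def lookup_add
    by (meson add_leD2)
  ultimately show ?thesis
    using ab indep_sets_mono unfolding indep_mons_iff by blast
qed

lemma monomials_add: "a + b \<in> monomials n \<longleftrightarrow> a \<in> monomials n \<and> b \<in> monomials n"
  by (auto simp: monomials_def in_keys_iff lookup_add subset_iff)

lemma var_mon_monomials: "t \<in> {1..n} \<Longrightarrow> var_mon t \<in> monomials n"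
  by (simp add: monomials_def var_mon_def)

lemma mon_add_diff:
  fixes g m :: mon
  assumes "\<And>t. Poly_Mapping.lookup g t \<le> Poly_Mapping.lookup m t"
  shows "m = g + (m - g)"
  by (rule poly_mapping_eqI) (simp add: lookup_add lookup_minus assms)

text \<open>A dependent monomial has an exponent of at least 2, or is square-free with a forbidden
  pair in its support. Either way a generator of the ideal divides it.\<close>

lemma not_indep_mon_cases:
  assumes ij: "1 \<le> i" "i < j" "j \<le> n"
    and m: "m \<in> monomials n" "m \<notin> indep_mons n i j"
  obtains t m' where "t \<in> {1..n}" "m = var_mon t + var_mon t + m'"
  | g m' where "g \<in> RLex_mons n i j" "m = g + m'"
proof (cases "squarefree_mon m")
  case False
  then obtain t where t: "2 \<le> Poly_Mapping.lookup m t"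
    unfolding squarefree_mon_def by (metis not_less_eq_eq numeral_2_eq_2 One_nat_def)
  then have "t \<in> {1..n}"
    using m(1) by (force simp: monomials_def in_keys_iff subset_iff)
  moreover have "m = var_mon t + var_mon t + (m - (var_mon t + var_mon t))"
    using t by (intro mon_add_diff) (simp add: lookup_add lookup_var_mon)
  ultimately show ?thesis by (rule that(1))
next
  case True
  with m have "Poly_Mapping.keys m \<notin> indep_sets n i j" "Poly_Mapping.keys m \<subseteq> {1..n}"
    by (simp_all add: indep_mons_iff monomials_def)
  then obtain a b where ab: "a \<in> Poly_Mapping.keys m" "b \<in> Poly_Mapping.keys m" "a < b"
    "b < j \<or> b = j \<and> a \<le> i" "1 \<le> a"
    unfolding indep_sets_def by fastforce
  have "b \<le> j - 1" if "b < j" using that by simp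
  with ab have "var_mon a + var_mon b \<in> RLex_mons n i j"
    unfolding RLex_mons_eq[OF ij] by blast
  moreover have "m = var_mon a + var_mon b + (m - (var_mon a + var_mon b))"
    using ab by (intro mon_add_diff) (auto simp: lookup_add lookup_var_mon in_keys_iff)
  ultimately show ?thesis by (rule that(2))
qed

lemma RLex_mon_not_indep:
  assumes ij: "1 \<le> i" "i < j" "j \<le> n" and g: "g \<in> RLex_mons n i j"
  shows "g \<notin> indep_mons n i j"
proof -
  from g obtain a b where ab: "g = var_mon a + var_mon b" "a < b" "b < j \<or> b = j \<and> a \<le> i"
    unfolding RLex_mons_eq[OF ij] using ij by fastforce
  then have "{a, b} \<subseteq> Poly_Mapping.keys g"
    by (simp add: in_keys_iff lookup_add lookup_var_mon)
  with ab show ?thesis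
    unfolding indep_mons_iff indep_sets_def by blast
qed

lemma finite_indep_sets: "finite (indep_sets n i j)"
proof (rule finite_subset)
  show "indep_sets n i j \<subseteq> Pow {1..n}" unfolding indep_sets_def by blast
qed simp

lemma mpoly_ring_simps:
  "p \<in> carrier (mpoly_ring n) \<longleftrightarrow> Poly_Mapping.keys p \<subseteq> monomials n"
  "p \<otimes>\<^bsub>mpoly_ring n\<^esub> q = p * q" "p \<oplus>\<^bsub>mpoly_ring n\<^esub> q = p + q"
  "\<one>\<^bsub>mpoly_ring n\<^esub> = 1" "\<zero>\<^bsub>mpoly_ring n\<^esub> = 0"
  by (simp_all add: mpoly_ring_def)

text \<open>Closure under multiplication is \<open>indep_mons_add\<close> read contrapositively:
  each monomial of \<open>q * p\<close> is a multiple of a monomial of \<open>p\<close>.\<close>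

lemma ideal_avoiding_indep_mons:
  "ideal {p \<in> carrier (mpoly_ring n :: 'k::field mpoly ring). Poly_Mapping.keys p \<inter> indep_mons n i j = {}}
     (mpoly_ring n)" (is "ideal ?J ?R")
proof -
  interpret R: cring ?R by (rule cring_mpoly_ring)
  have neg: "\<ominus>\<^bsub>?R\<^esub> p = - p" if "p \<in> carrier ?R" for p
    using that by (intro R.minus_equality) (simp_all add: mpoly_ring_simps)
  have sub: "subgroup ?J (add_monoid ?R)"
  proof
    fix p q assume pq: "p \<in> ?J" "q \<in> ?J"
    then have "p \<oplus>\<^bsub>?R\<^esub> q \<in> carrier ?R" by blast
    moreover have "Poly_Mapping.keys (p + q) \<inter> indep_mons n i j = {}"
      using pq Poly_Mapping.keys_add[of p q] by blast
    ultimately show "p \<otimes>\<^bsub>add_monoid ?R\<^esub> q \<in> ?J"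
      unfolding monoid.simps mpoly_ring_simps(3) by blast
  next
    fix p assume "p \<in> ?J"
    then have "inv\<^bsub>add_monoid ?R\<^esub> p = - p" "- p \<in> ?J"
      using neg[of p] by (simp_all add: a_inv_def mpoly_ring_simps)
    then show "inv\<^bsub>add_monoid ?R\<^esub> p \<in> ?J" by metis
  next
    show "?J \<subseteq> carrier (add_monoid ?R)" by auto
    show "\<one>\<^bsub>add_monoid ?R\<^esub> \<in> ?J" by (simp add: mpoly_ring_simps)
  qed
  have mult: "q * p \<in> ?J" if "p \<in> ?J" "q \<in> carrier ?R" for p q
  proof -
    have "q \<otimes>\<^bsub>?R\<^esub> p \<in> carrier ?R" using that by blast
    moreover have "m \<notin> indep_mons n i j" if m: "m \<in> Poly_Mapping.keys (q * p)" for m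
    proof -
      obtain a b where ab: "m = a + b" "b \<in> Poly_Mapping.keys p"
        using keys_mult[of q p] m by blast
      then have "b \<notin> indep_mons n i j" using \<open>p \<in> ?J\<close> by blast
      with indep_mons_add[of a b] ab(1) show ?thesis by metis
    qed
    ultimately show ?thesis unfolding mpoly_ring_simps(2) by blast
  qed
  show ?thesis
  proof (rule idealI[OF R.ring_axioms sub])
    fix p q assume "p \<in> ?J" "q \<in> carrier ?R"
    then have "q * p \<in> ?J" by (rule mult)
    then show "q \<otimes>\<^bsub>?R\<^esub> p \<in> ?J" "p \<otimes>\<^bsub>?R\<^esub> q \<in> ?J"
      by (simp_all only: mpoly_ring_simps(2) mult.commute[of p q])
  qed
qed

text \<open>One inclusion holds because the right side is an ideal containing all generators. For
  the other, each term of \<open>p\<close> is a multiple of a generator.\<close>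

lemma ideal_I_eq:
  assumes ij: "1 \<le> i" "i < j" "j \<le> n"
  shows "(ideal_I n i j :: 'k::field mpoly set) =
    {p \<in> carrier (mpoly_ring n). Poly_Mapping.keys p \<inter> indep_mons n i j = {}}" (is "?I = ?J")
proof -
  let ?R = "mpoly_ring n :: 'k mpoly ring"
  interpret R: cring ?R by (rule cring_mpoly_ring)
  interpret I: ideal ?I ?R by (rule ideal_ideal_I)
  interpret J: ideal ?J ?R by (rule ideal_avoiding_indep_mons)
  let ?Q = "{mon_poly (var_mon t) ^ 2 | t. t \<in> {1..n}} :: 'k mpoly set"
  have sq: "mon_poly (var_mon t) ^ 2 = Poly_Mapping.single (var_mon t + var_mon t) (1 :: 'k)" for t
    by (simp add: mon_poly_def power2_eq_square mult_single)
  have dbl: "var_mon t + var_mon t \<notin> indep_mons n i j" for t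
  proof -
    have "\<not> Poly_Mapping.lookup (var_mon t + var_mon t) t \<le> 1"
      by (simp add: lookup_add lookup_var_mon)
    then show ?thesis unfolding indep_mons_iff squarefree_mon_def by blast
  qed
  have rl: "RLex_mons n i j \<subseteq> monomials n" by (auto simp: RLex_mons_def)
  have QJ: "?Q \<subseteq> ?J"
  proof
    fix q :: "'k mpoly" assume "q \<in> ?Q"
    then obtain t where t: "t \<in> {1..n}" "q = Poly_Mapping.single (var_mon t + var_mon t) 1"
      unfolding sq by blast
    then have "var_mon t + var_mon t \<in> monomials n"
      using var_mon_monomials by (simp add: monomials_add)
    with t dbl show "q \<in> ?J" by (simp add: mpoly_ring_simps)
  qed
  have LJ: "mon_poly ` RLex_mons n i j \<subseteq> ?J"
  proof
    fix q :: "'k mpoly" assume "q \<in> mon_poly ` RLex_mons n i j"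
    then obtain g where g: "g \<in> RLex_mons n i j" "q = mon_poly g" by blast
    with rl RLex_mon_not_indep[OF ij g(1)] show "q \<in> ?J"
      by (simp add: mon_poly_def mpoly_ring_simps subset_iff)
  qed
  have Qc: "?Q \<subseteq> carrier ?R" and Lc: "mon_poly ` RLex_mons n i j \<subseteq> carrier ?R"
    using QJ LJ by blast+
  interpret Q: ideal "squares_ideal n :: 'k mpoly set" ?R
    unfolding squares_ideal_def by (rule R.genideal_ideal[OF Qc])
  interpret L: ideal "RLex n i j :: 'k mpoly set" ?R
    unfolding RLex_def by (rule R.genideal_ideal[OF Lc])
  have sum_mem: "q \<oplus>\<^bsub>?R\<^esub> l \<in> ?I" if "q \<in> squares_ideal n" "l \<in> RLex n i j" for q l
    unfolding ideal_I_def set_add_def' by (intro UN_I[OF that(1)] UN_I[OF that(2)] singletonI)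
  have QIJ: "squares_ideal n \<subseteq> ?J"
    unfolding squares_ideal_def by (rule R.genideal_minimal[OF J.ideal_axioms QJ])
  have LIJ: "RLex n i j \<subseteq> ?J"
    unfolding RLex_def by (rule R.genideal_minimal[OF J.ideal_axioms LJ])
  have "?I \<subseteq> ?J"
  proof
    fix p assume "p \<in> ?I"
    then obtain q l where p: "q \<in> squares_ideal n" "l \<in> RLex n i j" "p = q \<oplus>\<^bsub>?R\<^esub> l"
      unfolding ideal_I_def set_add_def' by blast
    show "p \<in> ?J"
      unfolding p(3) by (rule J.a_closed[OF subsetD[OF QIJ p(1)] subsetD[OF LIJ p(2)]])
  qed
  moreover have "?J \<subseteq> ?I"
  proof
    fix p assume p: "p \<in> ?J"
    have gen: "Poly_Mapping.single m c \<in> ?I"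
      if m: "m \<in> monomials n" "m \<notin> indep_mons n i j" for m and c :: 'k
      using ij m
    proof (cases rule: not_indep_mon_cases)
      case (1 t m')
      have "mon_poly (var_mon t) ^ 2 \<in> ?Q" using 1(1) by blast
      then have "(mon_poly (var_mon t) ^ 2 :: 'k mpoly) \<in> squares_ideal n"
        unfolding squares_ideal_def by (rule subsetD[OF R.genideal_self[OF Qc]])
      \<comment> \<open>A generator of one summand enters the sum of the two ideals by adding the
        zero of the other.\<close>
      from sum_mem[OF this L.zero_closed] have "Poly_Mapping.single (var_mon t + var_mon t) 1 \<in> ?I"
        by (simp add: mpoly_ring_simps sq)
      moreover have "Poly_Mapping.single m' c \<in> carrier ?R"
        using m 1 by (simp add: mpoly_ring_simps monomials_add)
      ultimately have "Poly_Mapping.single (var_mon t + var_mon t) 1 \<otimes>\<^bsub>?R\<^esub> Poly_Mapping.single m' c \<in> ?I"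
        by (rule I.I_r_closed)
      then show ?thesis
        unfolding mpoly_ring_simps(2) mult_single 1 by simp
    next
      case (2 g m')
      have "(mon_poly g :: 'k mpoly) \<in> RLex n i j"
        unfolding RLex_def by (rule subsetD[OF R.genideal_self[OF Lc] imageI[OF 2(1)]])
      from sum_mem[OF Q.zero_closed this] have "Poly_Mapping.single g 1 \<in> ?I" by (simp add: mpoly_ring_simps mon_poly_def)
      moreover have "Poly_Mapping.single m' c \<in> carrier ?R"
        using m 2 by (simp add: mpoly_ring_simps monomials_add)
      ultimately have "Poly_Mapping.single g 1 \<otimes>\<^bsub>?R\<^esub> Poly_Mapping.single m' c \<in> ?I"
        by (rule I.I_r_closed)
      then show ?thesis
        unfolding mpoly_ring_simps(2) mult_single 2 by simp
    qed
    \<comment> \<open>The claim about arbitrary sets \<open>B\<close> of monomials of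
      \<open>p\<close> allows an induction that adds one term at a time.\<close>
    have "(\<Sum>m\<in>B. Poly_Mapping.single m (Poly_Mapping.lookup p m)) \<in> ?I"
      if "B \<subseteq> Poly_Mapping.keys p" for B
      using finite_subset[OF that finite_keys] that
    proof (induction B rule: finite_induct)
      case empty
      show ?case using I.zero_closed by (simp add: mpoly_ring_simps)
    next
      case (insert m B)
      from p have "Poly_Mapping.keys p \<subseteq> monomials n" "Poly_Mapping.keys p \<inter> indep_mons n i j = {}"
        by (simp_all add: mpoly_ring_simps)
      with insert.prems have "m \<in> monomials n" "m \<notin> indep_mons n i j" by blast+
      moreover have "(\<Sum>m\<in>B. Poly_Mapping.single m (Poly_Mapping.lookup p m)) \<in> ?I"
        using insert by blast
      ultimately have "Poly_Mapping.single m (Poly_Mapping.lookup p m) \<oplus>\<^bsub>?R\<^esub>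
          (\<Sum>m\<in>B. Poly_Mapping.single m (Poly_Mapping.lookup p m)) \<in> ?I"
        by (intro I.a_closed gen)
      then show ?case using insert.hyps by (simp add: mpoly_ring_simps)
    qed
    from this[OF subset_refl] show "p \<in> ?I" by (simp add: poly_mapping_sum_single)
  qed
  ultimately show ?thesis by blast
qed

section \<open>Multiplication by \<open>\<ell>\<close> and homogeneous parts in coordinates\<close>

lemma indep_coeffs_add: "indep_coeffs n i j (p + q) S = indep_coeffs n i j p S + indep_coeffs n i j q S"
  by (simp add: indep_coeffs_def lookup_add)

lemma indep_coeffs_diff: "indep_coeffs n i j (p - q) S = indep_coeffs n i j p S - indep_coeffs n i j q S"
  by (simp add: indep_coeffs_def lookup_minus)

lemma lookup_var_mon_mult:
  fixes p :: "'k::field mpoly"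
  assumes S: "finite S"
  shows "Poly_Mapping.lookup (mon_poly (var_mon t) * p) (set_mon S) =
    (if t \<in> S then Poly_Mapping.lookup p (set_mon (S - {t})) else 0)"
proof (cases "t \<in> S")
  case True
  then show ?thesis
    unfolding mon_poly_def set_mon_remove[OF S True] lookup_single_mult_add by simp
next
  case False
  have "var_mon t + b \<noteq> set_mon S" for b
  proof
    assume eq: "var_mon t + b = set_mon S"
    have "Poly_Mapping.lookup (var_mon t + b) t = 0"
      unfolding eq using S False by (simp add: lookup_set_mon)
    then show False by (simp add: lookup_add lookup_var_mon)
  qed
  with False show ?thesis by (simp add: mon_poly_def lookup_single_mult)
qed

text \<open>Dropping the dependent monomials commutes with multiplication by \<open>\<ell>\<close>:
  the coefficient at an independent \<open>S\<close> comes from the sets \<open>S - {t}\<close>,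
  which are independent too.\<close>

lemma indep_coeffs_mult:
  "indep_coeffs n i j (sum_of_vars n * p) = sum_of_vars_map (indep_sets n i j) (indep_coeffs n i j p)"
proof
  fix S
  show "indep_coeffs n i j (sum_of_vars n * p) S =
    sum_of_vars_map (indep_sets n i j) (indep_coeffs n i j p) S"
  proof (cases "S \<in> indep_sets n i j")
    case True
    have sub: "S \<subseteq> {1..n}" and fin: "finite S"
      using indep_sets_subset[OF True] indep_sets_finite[OF True] .
    have "indep_coeffs n i j (sum_of_vars n * p) S =
        (\<Sum>t\<in>{1..n}. if t \<in> S then Poly_Mapping.lookup p (set_mon (S - {t})) else 0)"
      using True
      by (simp only: indep_coeffs_def sum_of_vars_def sum_distrib_right lookup_sum
          lookup_var_mon_mult[OF fin] if_True)
    also have "\<dots> = (\<Sum>t\<in>{1..n} \<inter> S. Poly_Mapping.lookup p (set_mon (S - {t})))"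
      by (rule sum.inter_restrict[symmetric]) simp
    also have "{1..n} \<inter> S = S" using sub by blast
    also have "(\<Sum>t\<in>S. Poly_Mapping.lookup p (set_mon (S - {t}))) =
        (\<Sum>t\<in>S. indep_coeffs n i j p (S - {t}))"
    proof (rule sum.cong[OF refl])
      fix t
      have "S - {t} \<in> indep_sets n i j" by (rule indep_sets_mono[OF True]) blast
      then show "Poly_Mapping.lookup p (set_mon (S - {t})) = indep_coeffs n i j p (S - {t})"
        by (simp add: indep_coeffs_def)
    qed
    finally show ?thesis using True by (simp add: sum_of_vars_map_def)
  next
    case False
    then show ?thesis by (simp add: indep_coeffs_def sum_of_vars_map_def)
  qed
qed

lemma indep_coeffs_pow_mult:
  "indep_coeffs n i j (sum_of_vars n ^ s * p) =
    (sum_of_vars_map (indep_sets n i j) ^^ s) (indep_coeffs n i j p)"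
  by (induction s) (simp_all add: mult.assoc indep_coeffs_mult)

lemma sum_of_vars_homogeneous: "(sum_of_vars n :: 'k::field mpoly) \<in> homogeneous n 1"
proof -
  have k: "Poly_Mapping.keys (sum_of_vars n :: 'k mpoly) \<subseteq> var_mon ` {1..n}"
  proof
    fix m assume m: "m \<in> Poly_Mapping.keys (sum_of_vars n :: 'k mpoly)"
    show "m \<in> var_mon ` {1..n}"
    proof (rule ccontr)
      assume "m \<notin> var_mon ` {1..n}"
      then have "Poly_Mapping.lookup (sum_of_vars n :: 'k mpoly) m = 0"
        unfolding sum_of_vars_def mon_poly_def lookup_sum
        by (intro sum.neutral ballI) (auto simp: lookup_single when_def)
      with m show False by (simp add: in_keys_iff)
    qed
  qed
  have "m \<in> monomials n \<and> mon_deg m = 1"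
    if m: "m \<in> Poly_Mapping.keys (sum_of_vars n :: 'k mpoly)" for m
  proof -
    obtain t where t: "m = var_mon t" "t \<in> {1..n}" using subsetD[OF k m] by blast
    then show ?thesis using var_mon_monomials[OF t(2)] by (simp add: mon_deg_def var_mon_def)
  qed
  then show ?thesis
    unfolding homogeneous_def mpoly_ring_simps(1) by blast
qed

lemma homogeneous_carrier: "p \<in> homogeneous n d \<Longrightarrow> p \<in> carrier (mpoly_ring n)"
  by (simp add: homogeneous_def)

lemma indep_coeffs_forms:
  assumes "p \<in> homogeneous n d"
  shows "indep_coeffs n i j p \<in> forms (indep_sets n i j) d"
  unfolding forms_def
proof (intro CollectI allI impI)
  fix S assume "indep_coeffs n i j p S \<noteq> 0"
  then have S: "S \<in> indep_sets n i j" "Poly_Mapping.lookup p (set_mon S) \<noteq> 0"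
    by (simp_all add: indep_coeffs_def split: if_splits)
  from S(2) have "set_mon S \<in> Poly_Mapping.keys p" by (simp only: in_keys_iff not_False_eq_True)
  with assms have "mon_deg (set_mon S) = d" unfolding homogeneous_def by blast
  with S(1) show "S \<in> indep_sets n i j \<and> card S = d"
    by (simp add: mon_deg_set_mon[OF indep_sets_finite[OF S(1)]])
qed

text \<open>The combination of the \<open>x\<^sub>S\<close> with coefficients \<open>f S\<close>
  works, since distinct sets give distinct monomials. It turns preimages among coordinate functions
  into preimages in the algebra.\<close>

lemma forms_indep_coeffs:
  assumes f: "f \<in> forms (indep_sets n i j) d"
  obtains p where "p \<in> homogeneous n d" "indep_coeffs n i j p = f"
proof -
  define p where "p = (\<Sum>S\<in>indep_sets n i j. Poly_Mapping.single (set_mon S) (f S))"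
  have inj: "S = T" if "S \<in> indep_sets n i j" "T \<in> indep_sets n i j" "set_mon S = set_mon T" for S T
    by (metis indep_sets_finite keys_set_mon that)
  have lookup_p: "Poly_Mapping.lookup p m =
      (\<Sum>S\<in>indep_sets n i j. if set_mon S = m then f S else 0)" for m
    by (simp only: p_def lookup_sum lookup_single when_def)
  have "indep_coeffs n i j p = f"
  proof
    fix T show "indep_coeffs n i j p T = f T"
    proof (cases "T \<in> indep_sets n i j")
      case True
      have "(\<Sum>S\<in>indep_sets n i j. if set_mon S = set_mon T then f S else 0) =
          (\<Sum>S\<in>indep_sets n i j. if S = T then f S else 0)"
      proof (rule sum.cong[OF refl])
        fix S assume "S \<in> indep_sets n i j"
        then have "set_mon S = set_mon T \<longleftrightarrow> S = T" using inj[OF _ True] by blast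
        then show "(if set_mon S = set_mon T then f S else 0) = (if S = T then f S else 0)" by simp
      qed
      also have "\<dots> = f T"
        unfolding sum.delta[OF finite_indep_sets] using True by (rule if_P)
      finally show ?thesis using True by (simp only: indep_coeffs_def lookup_p if_True)
    next
      case False
      then have "f T = 0" using formsD[OF f] by blast
      with False show ?thesis by (simp add: indep_coeffs_def)
    qed
  qed
  moreover have "p \<in> homogeneous n d"
  proof -
    have "m \<in> monomials n \<and> mon_deg m = d" if "m \<in> Poly_Mapping.keys p" for m
    proof -
      from that have "(\<Sum>S\<in>indep_sets n i j. if set_mon S = m then f S else 0) \<noteq> 0"
        by (simp only: in_keys_iff lookup_p not_False_eq_True)
      then obtain S where S: "S \<in> indep_sets n i j" "(if set_mon S = m then f S else 0) \<noteq> 0"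
        by (rule sum.not_neutral_contains_not_neutral)
      then have m: "set_mon S = m" "f S \<noteq> 0" by metis+
      have "card S = d" using formsD[OF f m(2)] by blast
      then show ?thesis
        using set_mon_monomials[OF S(1)] mon_deg_set_mon[OF indep_sets_finite[OF S(1)]] m(1) by simp
    qed
    then show ?thesis unfolding homogeneous_def mpoly_ring_simps(1) by blast
  qed
  ultimately show thesis by (intro that)
qed

section \<open>The Lefschetz property in the quotient algebra\<close>

context
  fixes n i j :: nat
  assumes ij: "1 \<le> i" "i < j" "j \<le> n"
begin

lemma mem_ideal_I_iff:
  fixes p :: "'k::field mpoly"
  assumes "p \<in> carrier (mpoly_ring n)"
  shows "p \<in> ideal_I n i j \<longleftrightarrow> indep_coeffs n i j p = (\<lambda>_. 0)"
proof -
  have "p \<in> ideal_I n i j \<longleftrightarrow> (\<forall>S\<in>indep_sets n i j. Poly_Mapping.lookup p (set_mon S) = 0)"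
    unfolding ideal_I_eq[OF ij] indep_mons_def using assms
    by (simp add: disjoint_iff in_keys_iff) blast
  then show ?thesis by (simp add: indep_coeffs_def fun_eq_iff Ball_def)
qed

text \<open>The coordinate map is additive with kernel \<open>I\<close>, so computations in the
  quotient can be made with coordinates.\<close>

lemma coset_eq_iff:
  fixes p q :: "'k::field mpoly"
  assumes p: "p \<in> carrier (mpoly_ring n)" and q: "q \<in> carrier (mpoly_ring n)"
  shows "ideal_I n i j +>\<^bsub>mpoly_ring n\<^esub> p = ideal_I n i j +>\<^bsub>mpoly_ring n\<^esub> q \<longleftrightarrow>
    indep_coeffs n i j p = indep_coeffs n i j q" (is "?I +>\<^bsub>?R\<^esub> p = _ \<longleftrightarrow> _")
proof -
  interpret I: ideal ?I ?R by (rule ideal_ideal_I)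
  have pq: "p - q \<in> carrier ?R"
    using p q Poly_Mapping.keys_diff[of p q] by (simp add: mpoly_ring_simps) blast
  show ?thesis
  proof
    assume "?I +>\<^bsub>?R\<^esub> p = ?I +>\<^bsub>?R\<^esub> q"
    with I.a_rcos_self[OF p] have "p \<in> ?I +>\<^bsub>?R\<^esub> q" by metis
    then obtain h where h: "h \<in> ?I" "p = h \<oplus>\<^bsub>?R\<^esub> q"
      unfolding a_r_coset_def' by blast
    have "indep_coeffs n i j h = (\<lambda>_. 0)"
      using mem_ideal_I_iff[OF I.a_Hcarr[OF h(1)]] h(1) by blast
    then show "indep_coeffs n i j p = indep_coeffs n i j q"
      unfolding h(2) by (simp add: mpoly_ring_simps fun_eq_iff indep_coeffs_add)
  next
    assume "indep_coeffs n i j p = indep_coeffs n i j q"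
    then have "p - q \<in> ?I"
      unfolding mem_ideal_I_iff[OF pq] by (simp add: fun_eq_iff indep_coeffs_diff)
    then have "(p - q) \<oplus>\<^bsub>?R\<^esub> q \<in> ?I +>\<^bsub>?R\<^esub> q"
      by (rule I.a_rcosI[OF _ I.a_subset q])
    then have "p \<in> ?I +>\<^bsub>?R\<^esub> q" by (simp add: mpoly_ring_simps)
    from I.a_repr_independence[OF this q I.a_subgroup]
    show "?I +>\<^bsub>?R\<^esub> p = ?I +>\<^bsub>?R\<^esub> q" by (rule sym)
  qed
qed

lemma algebra_A_pow_mult:
  fixes p :: "'k::field mpoly"
  assumes p: "p \<in> carrier (mpoly_ring n)"
  shows "(ideal_I n i j +>\<^bsub>mpoly_ring n\<^esub> sum_of_vars n) [^]\<^bsub>algebra_A n i j\<^esub> (s :: nat)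
      \<otimes>\<^bsub>algebra_A n i j\<^esub> (ideal_I n i j +>\<^bsub>mpoly_ring n\<^esub> p) =
    ideal_I n i j +>\<^bsub>mpoly_ring n\<^esub> (sum_of_vars n ^ s * p)"
    "sum_of_vars n ^ s * p \<in> carrier (mpoly_ring n)"
proof -
  let ?R = "mpoly_ring n :: 'k mpoly ring" and ?l = "sum_of_vars n :: 'k mpoly"
    and ?I = "ideal_I n i j :: 'k mpoly set"
  interpret R: cring ?R by (rule cring_mpoly_ring)
  interpret I: ideal ?I ?R by (rule ideal_ideal_I)
  have l: "?l \<in> carrier ?R"
    by (rule homogeneous_carrier[OF sum_of_vars_homogeneous])
  have mult: "(?I +>\<^bsub>?R\<^esub> a) \<otimes>\<^bsub>algebra_A n i j\<^esub> (?I +>\<^bsub>?R\<^esub> b) = ?I +>\<^bsub>?R\<^esub> (a * b)"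
    if "a \<in> carrier ?R" "b \<in> carrier ?R" for a b
    using I.rcoset_mult_add[OF that] by (simp add: algebra_A_def FactRing_def mpoly_ring_simps(2))
  have pow_carrier: "?l ^ s \<in> carrier ?R" for s
  proof (induction s)
    case 0
    show ?case using R.one_closed by (simp add: mpoly_ring_simps(4))
  next
    case (Suc s)
    from R.m_closed[OF l this] show ?case unfolding power_Suc mpoly_ring_simps(2) .
  qed
  have pow: "(?I +>\<^bsub>?R\<^esub> ?l) [^]\<^bsub>algebra_A n i j\<^esub> s = ?I +>\<^bsub>?R\<^esub> (?l ^ s)"
  proof (induction s)
    case 0
    show ?case by (simp add: nat_pow_def algebra_A_def FactRing_def mpoly_ring_simps(4))
  next
    case (Suc s)
    then show ?case
      using mult[OF pow_carrier[of s] l] by (simp add: nat_pow_def mult.commute)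
  qed
  show "sum_of_vars n ^ s * p \<in> carrier ?R"
    using R.m_closed[OF pow_carrier p] by (simp only: mpoly_ring_simps(2))
  show "(?I +>\<^bsub>?R\<^esub> ?l) [^]\<^bsub>algebra_A n i j\<^esub> s \<otimes>\<^bsub>algebra_A n i j\<^esub> (?I +>\<^bsub>?R\<^esub> p) =
    ?I +>\<^bsub>?R\<^esub> (?l ^ s * p)"
    unfolding pow by (rule mult[OF pow_carrier p])
qed

lemma strong_lefschetz_algebra_A:
  assumes lef: "lefschetz_about TYPE('k::field) (indep_sets n i j) c"
  shows "strong_lefschetz (algebra_A n i j) (grading_A n i j :: nat \<Rightarrow> 'k mpoly set set)"
proof -
  let ?R = "mpoly_ring n :: 'k mpoly ring" and ?I = "ideal_I n i j :: 'k mpoly set"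
    and ?A = "algebra_A n i j :: 'k mpoly set ring"
    and ?G = "grading_A n i j :: nat \<Rightarrow> 'k mpoly set set"
    and ?F = "indep_sets n i j" and ?h = "indep_coeffs n i j :: 'k mpoly \<Rightarrow> _"
  let ?L = "sum_of_vars_map ?F :: (nat set \<Rightarrow> 'k) \<Rightarrow> _"
  define l where "l = ?I +>\<^bsub>?R\<^esub> sum_of_vars n"
  note pow = algebra_A_pow_mult[where ?'k = 'k, folded l_def]
  have "l \<in> ?G 1"
    unfolding l_def grading_A_def by (rule imageI[OF sum_of_vars_homogeneous])
  moreover have "inj_on (\<lambda>a. (l [^]\<^bsub>?A\<^esub> s) \<otimes>\<^bsub>?A\<^esub> a) (?G d) \<or>
        (\<lambda>a. (l [^]\<^bsub>?A\<^esub> s) \<otimes>\<^bsub>?A\<^esub> a) ` ?G d = ?G (d + s)" for s d :: nat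
  \<comment> \<open>The threshold chooses the alternative: injectivity up to \<open>c\<close>,
    surjectivity beyond it.\<close>
  proof (cases "2 * d + s \<le> c")
    case True
    have "inj_on (\<lambda>a. (l [^]\<^bsub>?A\<^esub> s) \<otimes>\<^bsub>?A\<^esub> a) (?G d)"
    proof (rule inj_onI)
      fix a b assume "a \<in> ?G d" "b \<in> ?G d"
        and eq: "(l [^]\<^bsub>?A\<^esub> s) \<otimes>\<^bsub>?A\<^esub> a = (l [^]\<^bsub>?A\<^esub> s) \<otimes>\<^bsub>?A\<^esub> b"
      then obtain p q where p: "p \<in> homogeneous n d" "a = ?I +>\<^bsub>?R\<^esub> p"
        and q: "q \<in> homogeneous n d" "b = ?I +>\<^bsub>?R\<^esub> q"
        unfolding grading_A_def by blast
      note pc = homogeneous_carrier[OF p(1)] and qc = homogeneous_carrier[OF q(1)]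
      \<comment> \<open>By linearity, injectivity reduces to a zero kernel, tested on the difference
        of the coordinates.\<close>
      define f where "f = (\<lambda>S. 1 * ?h p S + (- 1) * ?h q S)"
      have f: "f \<in> forms ?F d"
        unfolding f_def by (rule lincomb_forms[OF indep_coeffs_forms[OF p(1)] indep_coeffs_forms[OF q(1)]])
      have "(?L ^^ s) (?h p) = (?L ^^ s) (?h q)"
        using eq unfolding p(2) q(2) pow(1)[OF pc] pow(1)[OF qc]
          coset_eq_iff[OF pow(2)[OF pc] pow(2)[OF qc]] indep_coeffs_pow_mult .
      then have "(?L ^^ s) f = (\<lambda>_. 0)"
        unfolding f_def pow_sum_of_vars_map_lincomb by simp
      then have "f = (\<lambda>_. 0)"
        using lef True f unfolding lefschetz_about_def by blast
      then have "?h p = ?h q"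
        unfolding f_def fun_eq_iff by simp
      then show "a = b"
        unfolding p(2) q(2) coset_eq_iff[OF pc qc] .
    qed
    then show ?thesis ..
  next
    case False
    have "(\<lambda>a. (l [^]\<^bsub>?A\<^esub> s) \<otimes>\<^bsub>?A\<^esub> a) ` ?G d = ?G (d + s)"
    proof (intro equalityI subsetI)
      fix b assume "b \<in> (\<lambda>a. (l [^]\<^bsub>?A\<^esub> s) \<otimes>\<^bsub>?A\<^esub> a) ` ?G d"
      then obtain p where p: "p \<in> homogeneous n d"
        and b: "b = (l [^]\<^bsub>?A\<^esub> s) \<otimes>\<^bsub>?A\<^esub> (?I +>\<^bsub>?R\<^esub> p)"
        unfolding grading_A_def by blast
      note pc = homogeneous_carrier[OF p]
      have "(?L ^^ s) (?h p) \<in> forms ?F (d + s)"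
        by (rule pow_sum_of_vars_map_forms[OF indep_sets_finite indep_coeffs_forms[OF p]])
      \<comment> \<open>A homogeneous representative of the product is rebuilt from its
        coordinates.\<close>
      then obtain q where q: "q \<in> homogeneous n (d + s)" "?h q = (?L ^^ s) (?h p)"
        by (rule forms_indep_coeffs)
      have "b = ?I +>\<^bsub>?R\<^esub> q"
        unfolding b pow(1)[OF pc] coset_eq_iff[OF pow(2)[OF pc] homogeneous_carrier[OF q(1)]]
          indep_coeffs_pow_mult q(2) ..
      then show "b \<in> ?G (d + s)"
        unfolding grading_A_def by (rule image_eqI[OF _ q(1)])
    next
      fix b assume "b \<in> ?G (d + s)"
      then obtain q where q: "q \<in> homogeneous n (d + s)" "b = ?I +>\<^bsub>?R\<^esub> q"
        unfolding grading_A_def by blast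
      obtain f where f: "f \<in> forms ?F d" "(?L ^^ s) f = ?h q"
        using lef False indep_coeffs_forms[OF q(1), of i j]
        unfolding lefschetz_about_def not_le by blast
      obtain p where p: "p \<in> homogeneous n d" "?h p = f"
        using f(1) by (rule forms_indep_coeffs)
      note pc = homogeneous_carrier[OF p(1)]
      have "b = (l [^]\<^bsub>?A\<^esub> s) \<otimes>\<^bsub>?A\<^esub> (?I +>\<^bsub>?R\<^esub> p)"
        unfolding q(2) pow(1)[OF pc] coset_eq_iff[OF homogeneous_carrier[OF q(1)] pow(2)[OF pc]]
          indep_coeffs_pow_mult p(2) f(2) ..
      moreover have "?I +>\<^bsub>?R\<^esub> p \<in> ?G d"
        unfolding grading_A_def by (rule imageI[OF p(1)])
      ultimately show "b \<in> (\<lambda>a. (l [^]\<^bsub>?A\<^esub> s) \<otimes>\<^bsub>?A\<^esub> a) ` ?G d"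
        by (rule image_eqI)
    qed
    then show ?thesis ..
  qed
  ultimately show ?thesis
    unfolding strong_lefschetz_def by (intro bexI[of _ l] allI)
qed

section \<open>Socle degree and characteristic\<close>

lemma grading_A_nonzero_iff:
  "grading_A n i j d \<noteq> {\<zero>\<^bsub>algebra_A n i j :: 'k::field mpoly set ring\<^esub>} \<longleftrightarrow>
    (\<exists>S\<in>indep_sets n i j. card S = d)"
proof -
  let ?R = "mpoly_ring n :: 'k mpoly ring" and ?I = "ideal_I n i j :: 'k mpoly set"
    and ?F = "indep_sets n i j"
  interpret R: cring ?R by (rule cring_mpoly_ring)
  interpret I: ideal ?I ?R by (rule ideal_ideal_I)
  have zero: "\<zero>\<^bsub>algebra_A n i j\<^esub> = ?I"
    by (simp add: algebra_A_def FactRing_def)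
  have coset_0: "?I +>\<^bsub>?R\<^esub> 0 = ?I"
    using I.a_rcos_const[OF I.zero_closed] by (simp add: mpoly_ring_simps)
  have "(0 :: 'k mpoly) \<in> carrier ?R" by (simp add: mpoly_ring_simps)
  note coset_eq_0 = coset_eq_iff[OF _ this, unfolded coset_0]
  have h0: "indep_coeffs n i j (0 :: 'k mpoly) = (\<lambda>_. 0)"
    by (simp add: indep_coeffs_def fun_eq_iff)
  show ?thesis
  proof
    assume nz: "grading_A n i j d \<noteq> {\<zero>\<^bsub>algebra_A n i j :: 'k mpoly set ring\<^esub>}"
    show "\<exists>S\<in>?F. card S = d"
    proof (rule ccontr)
      assume no: "\<not> (\<exists>S\<in>?F. card S = d)"
      have "?I +>\<^bsub>?R\<^esub> p = ?I" if p: "p \<in> homogeneous n d" for p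
      proof -
        have "indep_coeffs n i j p = (\<lambda>_. 0)"
          using no by (intro forms_eqI[OF indep_coeffs_forms[OF p] zero_forms]) blast
        then show ?thesis
          using coset_eq_0[OF homogeneous_carrier[OF p]] h0 by simp
      qed
      moreover have "(0 :: 'k mpoly) \<in> homogeneous n d"
        by (simp add: homogeneous_def mpoly_ring_simps)
      ultimately have "grading_A n i j d = {?I}"
        unfolding grading_A_def by blast
      with nz show False unfolding zero by blast
    qed
  next
    assume "\<exists>S\<in>?F. card S = d"
    then obtain S where S: "S \<in> ?F" "card S = d" by blast
    define p :: "'k mpoly" where "p = mon_poly (set_mon S)"
    have p: "p \<in> homogeneous n d"
      using set_mon_monomials[OF S(1)] mon_deg_set_mon[OF indep_sets_finite[OF S(1)]] S(2)
      by (simp add: p_def homogeneous_def mpoly_ring_simps mon_poly_def)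
    have "indep_coeffs n i j p S = 1"
      using S(1) by (simp add: indep_coeffs_def p_def mon_poly_def lookup_single)
    then have "indep_coeffs n i j p \<noteq> indep_coeffs n i j 0"
      unfolding h0 by (metis zero_neq_one)
    then have "?I +>\<^bsub>?R\<^esub> p \<noteq> ?I"
      using coset_eq_0[OF homogeneous_carrier[OF p]] by blast
    moreover have "?I +>\<^bsub>?R\<^esub> p \<in> grading_A n i j d"
      unfolding grading_A_def by (rule imageI[OF p])
    ultimately show "grading_A n i j d \<noteq> {\<zero>\<^bsub>algebra_A n i j :: 'k mpoly set ring\<^esub>}"
      unfolding zero by blast
  qed
qed

text \<open>This inequality makes a characteristic above \<open>D\<close> lie above the threshold as
  well.\<close>

lemma core_top_le_socle_degree:
  "core_top i j + (n - j) \<le>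
    socle_degree (algebra_A n i j) (grading_A n i j :: nat \<Rightarrow> 'k::field mpoly set set)"
  unfolding socle_degree_def grading_A_nonzero_iff
proof (rule Greatest_le_nat)
  show "\<exists>S\<in>indep_sets n i j. card S = core_top i j + (n - j)"
    by (rule card_indep_sets[OF ij])
  \<comment> \<open>The bound by \<open>n\<close> guarantees that the greatest such degree
    exists.\<close>
  fix d assume "\<exists>S\<in>indep_sets n i j. card S = d"
  then obtain S where S: "S \<in> indep_sets n i j" "card S = d" by blast
  from card_mono[OF finite_atLeastAtMost indep_sets_subset[OF S(1)]] show "d \<le> n"
    unfolding S(2) by simp
qed

lemma strong_lefschetz_if_CHAR:
  assumes "CHAR('k::field) = 0 \<or> core_top i j + (n - j) < CHAR('k)"
  shows "strong_lefschetz (algebra_A n i j) (grading_A n i j :: nat \<Rightarrow> 'k mpoly set set)"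
proof (rule strong_lefschetz_algebra_A[OF lefschetz_about_indep_sets[OF ij]])
  fix s assume "1 \<le> s" "s \<le> core_top i j + (n - j)"
  \<comment> \<open>A positive characteristic dividing \<open>s\<close> would be at most
    \<open>s\<close>, and 0 divides no positive number.\<close>
  with assms have "\<not> CHAR('k) dvd s"
    by (auto dest: dvd_imp_le)
  then show "of_nat s \<noteq> (0 :: 'k)"
    by (simp add: of_nat_eq_0_iff_char_dvd)
qed

lemma core_top_le: "core_top i j + (n - j) \<le> n"
  using ij unfolding core_top_def by presburger

end

text \<open>The threshold is at most \<open>D\<close> and at most \<open>n\<close>, so either bound
  on the characteristic exceeds it. Characteristic zero, encoded as \<open>CHAR('k) = 0\<close>,
  counts as larger than \<open>D\<close>.\<close>

theorem theorem3p3: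
  fixes n i j D :: nat
    and A :: "'k::field mpoly set ring"
    and G :: "nat \<Rightarrow> 'k mpoly set set"
  assumes "1 \<le> i" and "i < j" and "j \<le> n"
    and "A = algebra_A n i j"
    and "G = grading_A n i j"
    and "D = socle_degree A G"
  shows "(CHAR('k) = 0 \<or> D < CHAR('k) \<longrightarrow> strong_lefschetz A G) \<and>
    (n < CHAR('k) \<longrightarrow> strong_lefschetz A G)"
proof -
  have "core_top i j + (n - j) \<le> D"
    unfolding assms(4-6) by (rule core_top_le_socle_degree[OF assms(1-3)])
  moreover have "core_top i j + (n - j) \<le> n"
    by (rule core_top_le[OF assms(1-3)])
  moreover have "strong_lefschetz A G"
    if "CHAR('k) = 0 \<or> core_top i j + (n - j) < CHAR('k)"
    unfolding assms(4,5) by (rule strong_lefschetz_if_CHAR[OF assms(1-3) that])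
  ultimately show ?thesis by linarith
qed

end
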